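(* Let $(\mathscr{C},\mathbb{E},\mathfrak{s})$ be a pre-extriangulated category. Then the following statements are equivalent (all conditions being spelled out in the context): (a) $\mathscr{C}$ satisfies (ET4). (b) $\mathscr{C}$ satisfies (ET4-1) and (ET0). (c) $\mathscr{C}$ satisfies (ET4-2) and (ET0). (d) $\mathscr{C}$ satisfies (ET4-3) and (ET0). (e) $\mathscr{C}$ satisfies (ET4-5) and (ET0).
   Context: **Extensions.** Let $\mathscr{C}$ be an additive category and $\mathbb{E}:\mathscr{C}^{\mathrm{op}}\times\mathscr{C}\to\mathrm{Ab}$ a biadditive functor. An element $\delta\in\mathbb{E}(C,A)$ is an $\mathbb{E}$-extension. For $a:A\to A'$ put $a_*\delta=\mathbb{E}(C,a)(\delta)\in\mathbb{E}(C,A')$; for $c:C'\to C$ put $c^*\delta=\mathbb{E}(c,A)(\delta)\in\mathbb{E}(C',A)$. For $\delta\in\mathbb{E}(C,A)$, $\delta'\in\mathbb{E}(C',A')$, a morphism of $\mathbb{E}$-extensions $(a,c):\delta\to\delta'$ is a pair $a:A\to A'$, $c:C\to C'$ with $a_*\delta=c^*\delta'$. $\delta\oplus\delta'\in\mathbb{E}(C\oplus C',A\oplus A')$ is the element corresponding to $(\delta,0,0,\delta')$ under $\mathbb{E}(C\oplus C',A\oplus A')\cong\mathbb{E}(C,A)\oplus\mathbb{E}(C,A')\oplus\mathbb{E}(C',A)\oplus\mathbb{E}(C',A')$. **Realizations.** Sequences $A\xrightarrow{x}B\xrightarrow{y}C$ and $A\xrightarrow{x'}B'\xrightarrow{y'}C$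 are equivalent if there is an isomorphism $b:B\to B'$ with $bx=x'$, $y'b=y$; $[A\xrightarrow{x}B\xrightarrow{y}C]$ is the equivalence class. A realization $\mathfrak{s}$ of $\mathbb{E}$ assigns to each $\delta\in\mathbb{E}(C,A)$ an equivalence class $\mathfrak{s}(\delta)=[A\xrightarrow{x}B\xrightarrow{y}C]$ such that for every morphism of $\mathbb{E}$-extensions $(a,c):\delta\to\delta'$ with $\mathfrak{s}(\delta)=[A\xrightarrow{x}B\xrightarrow{y}C]$ and $\mathfrak{s}(\delta')=[A'\xrightarrow{x'}B'\xrightarrow{y'}C']$ there is $b:B\to B'$ with $bx=x'a$ and $y'b=cy$. It is additive if $\mathfrak{s}(0)=[A\xrightarrow{\binom{1}{0}}A\oplus C\xrightarrow{(0,1)}C]$ for $0\in\mathbb{E}(C,A)$, and $\mathfrak{s}(\delta\oplus\delta')=\mathfrak{s}(\delta)\oplus\mathfrak{s}(\delta')$ (termwise direct sum) for all $\delta,\delta'$. If $\mathfrak{s}(\delta)=[A\xrightarrow{x}B\xrightarrow{y}C]$, then $A\xrightarrow{x}B\xrightarrow{y}C\overset{\delta}{\dashrightarrow}$ is called an $\mathbb{E}$-triangle (realizing $\delta$), and $x$ is called an inflation. A morphism of $\mathbb{E}$-triangles from $A\xrightarrow{x}B\xrightarrow{y}C\overset{\delta}{\dashrightarrow}$ to $A'\xrightarrow{x'}B'\xrightarrow{y'}C'\overset{\delta'}{\dashrightarrow}$ is a triple $(a,b,c)$ with $bx=x'a$, $y'b=cy$ and $a_*\delta=c^*\delta'$.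 **Pre-extriangulated category.** A triple $(\mathscr{C},\mathbb{E},\mathfrak{s})$ with $\mathscr{C}$ additive such that: (ET1) $\mathbb{E}:\mathscr{C}^{\mathrm{op}}\times\mathscr{C}\to\mathrm{Ab}$ is a biadditive functor; (ET2) $\mathfrak{s}$ is an additive realization of $\mathbb{E}$; (ET3) for any two $\mathbb{E}$-triangles $A\xrightarrow{x}B\xrightarrow{y}C\overset{\delta}{\dashrightarrow}$ and $A'\xrightarrow{x'}B'\xrightarrow{y'}C'\overset{\delta'}{\dashrightarrow}$ and any $a:A\to A'$, $b:B\to B'$ with $bx=x'a$, there is $c:C\to C'$ such that $(a,b,c)$ is a morphism of $\mathbb{E}$-triangles; (ET3)$^{\mathrm{op}}$ for any two $\mathbb{E}$-triangles $A\xrightarrow{x}B\xrightarrow{y}C\overset{\delta}{\dashrightarrow}$ and $A'\xrightarrow{x'}B'\xrightarrow{y'}C'\overset{\delta'}{\dashrightarrow}$ and any $b:B\to B'$, $c:C\to C'$ with $y'b=cy$, there is $a:A\to A'$ such that $(a,b,c)$ is a morphism of $\mathbb{E}$-triangles. **Conditions.** (ET0) If $f:A\to B$ and $g:B\to C$ are inflations, then $gf$ is an inflation. (ET4) For any $\mathbb{E}$-triangles $A\xrightarrow{f}B\xrightarrow{f'}D\overset{\delta}{\dashrightarrow}$ and $B\xrightarrow{g}C\xrightarrow{g'}F\overset{\delta'}{\dashrightarrow}$ there are an object $E$ and $\mathbb{E}$-triangles $A\xrightarrow{h}C\xrightarrow{h'}E\overset{\delta''}{\dashrightarrow}$ and $D\xrightarrow{d}E\xrightarrow{e}F\overset{f'_*\delta'}{\dashrightarrow}$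 such that $h=gf$, $df'=h'g$, $eh'=g'$, $d^*\delta''=\delta$ and $f_*\delta''=e^*\delta'$. (ET4-1) For any $\mathbb{E}$-triangles $A_1\xrightarrow{x_1}B_1\xrightarrow{y_1}C\overset{\delta_1}{\dashrightarrow}$ and $A_2\xrightarrow{x_2}B_2\xrightarrow{y_2}C\overset{\delta_2}{\dashrightarrow}$ there are an object $M$ and $\mathbb{E}$-triangles $A_1\xrightarrow{m_1}M\xrightarrow{e_1}B_2\overset{y_2^*\delta_1}{\dashrightarrow}$ and $A_2\xrightarrow{m_2}M\xrightarrow{e_2}B_1\overset{y_1^*\delta_2}{\dashrightarrow}$ such that $e_2m_1=x_1$, $e_1m_2=x_2$, $y_2e_1=y_1e_2$ and $(m_1)_*\delta_1+(m_2)_*\delta_2=0$. (ET4-2) For any $\mathbb{E}$-triangle $A\xrightarrow{x}B\xrightarrow{y}C\overset{\delta}{\dashrightarrow}$, any morphism $f:A\to D$, and any $\mathbb{E}$-triangle $D\xrightarrow{d}E\xrightarrow{e}C\overset{f_*\delta}{\dashrightarrow}$ realizing $f_*\delta$, there is $g:B\to E$ such that $(f,g,\mathrm{id}_C)$ is a morphism of $\mathbb{E}$-triangles (so $gx=df$, $eg=y$) and $A\xrightarrow{\binom{-f}{x}}D\oplus B\xrightarrow{(d,\,g)}E\overset{e^*\delta}{\dashrightarrow}$ is an $\mathbb{E}$-triangle. (ET4-3) For any $\mathbb{E}$-triangles $A\xrightarrow{f}B\xrightarrow{f'}D\overset{\delta_f}{\dashrightarrow}$, $B\xrightarrow{g}C\xrightarrow{g'}F\overset{\delta_g}{\dashrightarrow}$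 and $A\xrightarrow{h}C\xrightarrow{h_0}E_0\overset{\delta_h}{\dashrightarrow}$ with $h=gf$, there are morphisms $d_0:D\to E_0$ and $e_0:E_0\to F$ such that $d_0f'=h_0g$, $e_0h_0=g'$, $D\xrightarrow{d_0}E_0\xrightarrow{e_0}F\overset{f'_*\delta_g}{\dashrightarrow}$ is an $\mathbb{E}$-triangle, $d_0^*\delta_h=\delta_f$ and $f_*\delta_h=e_0^*\delta_g$. (ET4-5) For any $\mathbb{E}$-triangles $A_1\xrightarrow{x_1}B_1\xrightarrow{y_1}C\overset{\delta}{\dashrightarrow}$ and $A_2\xrightarrow{x_2}B_2\xrightarrow{y_2}C\overset{\delta'}{\dashrightarrow}$ and any $g:B_1\to B_2$ with $y_2g=y_1$, there is $f:A_1\to A_2$ such that $(f,g,\mathrm{id}_C)$ is a morphism of $\mathbb{E}$-triangles (so $x_2f=gx_1$, $f_*\delta=\delta'$) and $A_1\xrightarrow{\binom{-f}{x_1}}A_2\oplus B_1\xrightarrow{(x_2,\,g)}B_2\overset{y_2^*\delta}{\dashrightarrow}$ is an $\mathbb{E}$-triangle. *)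

theory Defs
  imports "HOL-Algebra.AbelCoset"
begin

text \<open>
  The category, the bifunctor and the realization are bundled in one record. Abelian groups are
  the \<^locale>\<open>abelian_group\<close>s of HOL-Algebra; as for the record of modules there, the fields
  for multiplication and unit of these ring records are never used.
  A morphism determines its domain and codomain (see \<open>Hom_disjoint\<close> below), whereas the
  groups \<open>Ext X C A\<close> may overlap. Therefore operations on extensions
  carry the objects \<open>C\<close>, \<open>A\<close> as arguments wherever these are not determined by a morphism.

  The direct sums \<open>A \<boxplus> B\<close> (with injections and projections) are chosen ones, so that all
  statements hold for an arbitrary choice.
\<close>

record ('o, 'm) additive_cat =
  Obj :: "'o set"
  Hom :: "'o \<Rightarrow> 'o \<Rightarrow> 'm ring"
  cmp :: "'m \<Rightarrow> 'm \<Rightarrow> 'm" (infixl "\<cdot>\<index>" 70)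
  ident :: "'o \<Rightarrow> 'm"
  dsum :: "'o \<Rightarrow> 'o \<Rightarrow> 'o" (infixl "\<boxplus>\<index>" 75)
  inj1 :: "'o \<Rightarrow> 'o \<Rightarrow> 'm"
  inj2 :: "'o \<Rightarrow> 'o \<Rightarrow> 'm"
  prj1 :: "'o \<Rightarrow> 'o \<Rightarrow> 'm"
  prj2 :: "'o \<Rightarrow> 'o \<Rightarrow> 'm"

text \<open>
  \<open>Ext X C A\<close> is the group $\mathbb{E}(C,A)$ and \<open>Emap X c a\<close> is the map
  $\mathbb{E}(c,a) : \mathbb{E}(C,A) \to \mathbb{E}(C',A')$ for $c : C' \to C$ and $a : A \to A'$.
  A sequence $A \to B \to C$ with given ends is encoded as the triple \<open>(B, x, y)\<close>;
  \<open>realize X C A \<delta>\<close> is an equivalence class of such triples.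
\<close>

record ('o, 'm, 'e) ext_cat = "('o, 'm) additive_cat" +
  Ext :: "'o \<Rightarrow> 'o \<Rightarrow> 'e ring"
  Emap :: "'m \<Rightarrow> 'm \<Rightarrow> 'e \<Rightarrow> 'e"
  realize :: "'o \<Rightarrow> 'o \<Rightarrow> 'e \<Rightarrow> ('o \<times> 'm \<times> 'm) set"


section \<open>Additive categories\<close>

locale additive_category =
  fixes X :: "('o, 'm, 'z) additive_cat_scheme" (structure)
  assumes Hom_disjoint:
      "\<lbrakk>A \<in> Obj X; B \<in> Obj X; A' \<in> Obj X; B' \<in> Obj X;
        f \<in> carrier (Hom X A B); f \<in> carrier (Hom X A' B')\<rbrakk> \<Longrightarrow> A = A' \<and> B = B'"
    and ident_closed: "A \<in> Obj X \<Longrightarrow> ident X A \<in> carrier (Hom X A A)"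
    and cmp_closed:
      "\<lbrakk>A \<in> Obj X; B \<in> Obj X; C \<in> Obj X; f \<in> carrier (Hom X A B); g \<in> carrier (Hom X B C)\<rbrakk>
       \<Longrightarrow> g \<cdot> f \<in> carrier (Hom X A C)"
    and cmp_ident_left:
      "\<lbrakk>A \<in> Obj X; B \<in> Obj X; f \<in> carrier (Hom X A B)\<rbrakk> \<Longrightarrow> ident X B \<cdot> f = f"
    and cmp_ident_right:
      "\<lbrakk>A \<in> Obj X; B \<in> Obj X; f \<in> carrier (Hom X A B)\<rbrakk> \<Longrightarrow> f \<cdot> ident X A = f"
    and cmp_assoc:
      "\<lbrakk>A \<in> Obj X; B \<in> Obj X; C \<in> Obj X; D \<in> Obj X; f \<in> carrier (Hom X A B);
        g \<in> carrier (Hom X B C); h \<in> carrier (Hom X C D)\<rbrakk>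
       \<Longrightarrow> (h \<cdot> g) \<cdot> f = h \<cdot> (g \<cdot> f)"
    and Hom_abelian_group: "\<lbrakk>A \<in> Obj X; B \<in> Obj X\<rbrakk> \<Longrightarrow> abelian_group (Hom X A B)"
    and cmp_add_left:
      "\<lbrakk>A \<in> Obj X; B \<in> Obj X; C \<in> Obj X; f \<in> carrier (Hom X A B);
        g \<in> carrier (Hom X B C); g' \<in> carrier (Hom X B C)\<rbrakk>
       \<Longrightarrow> (g \<oplus>\<^bsub>Hom X B C\<^esub> g') \<cdot> f = (g \<cdot> f) \<oplus>\<^bsub>Hom X A C\<^esub> (g' \<cdot> f)"
    and cmp_add_right:
      "\<lbrakk>A \<in> Obj X; B \<in> Obj X; C \<in> Obj X; f \<in> carrier (Hom X A B);
        f' \<in> carrier (Hom X A B); g \<in> carrier (Hom X B C)\<rbrakk>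
       \<Longrightarrow> g \<cdot> (f \<oplus>\<^bsub>Hom X A B\<^esub> f') = (g \<cdot> f) \<oplus>\<^bsub>Hom X A C\<^esub> (g \<cdot> f')"
    and zero_object:
      "\<exists>Z \<in> Obj X. \<forall>A \<in> Obj X. carrier (Hom X A Z) = {\<zero>\<^bsub>Hom X A Z\<^esub>} \<and>
                               carrier (Hom X Z A) = {\<zero>\<^bsub>Hom X Z A\<^esub>}"
    and dsum_closed: "\<lbrakk>A \<in> Obj X; B \<in> Obj X\<rbrakk> \<Longrightarrow> A \<boxplus> B \<in> Obj X"
    and inj1_closed: "\<lbrakk>A \<in> Obj X; B \<in> Obj X\<rbrakk> \<Longrightarrow> inj1 X A B \<in> carrier (Hom X A (A \<boxplus> B))"
    and inj2_closed: "\<lbrakk>A \<in> Obj X; B \<in> Obj X\<rbrakk> \<Longrightarrow> inj2 X A B \<in> carrier (Hom X B (A \<boxplus> B))"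
    and prj1_closed: "\<lbrakk>A \<in> Obj X; B \<in> Obj X\<rbrakk> \<Longrightarrow> prj1 X A B \<in> carrier (Hom X (A \<boxplus> B) A)"
    and prj2_closed: "\<lbrakk>A \<in> Obj X; B \<in> Obj X\<rbrakk> \<Longrightarrow> prj2 X A B \<in> carrier (Hom X (A \<boxplus> B) B)"
    and prj1_inj1: "\<lbrakk>A \<in> Obj X; B \<in> Obj X\<rbrakk> \<Longrightarrow> prj1 X A B \<cdot> inj1 X A B = ident X A"
    and prj2_inj2: "\<lbrakk>A \<in> Obj X; B \<in> Obj X\<rbrakk> \<Longrightarrow> prj2 X A B \<cdot> inj2 X A B = ident X B"
    and prj1_inj2: "\<lbrakk>A \<in> Obj X; B \<in> Obj X\<rbrakk> \<Longrightarrow> prj1 X A B \<cdot> inj2 X A B = \<zero>\<^bsub>Hom X B A\<^esub>"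
    and prj2_inj1: "\<lbrakk>A \<in> Obj X; B \<in> Obj X\<rbrakk> \<Longrightarrow> prj2 X A B \<cdot> inj1 X A B = \<zero>\<^bsub>Hom X A B\<^esub>"
    and inj_prj_sum:
      "\<lbrakk>A \<in> Obj X; B \<in> Obj X\<rbrakk>
       \<Longrightarrow> (inj1 X A B \<cdot> prj1 X A B) \<oplus>\<^bsub>Hom X (A \<boxplus> B) (A \<boxplus> B)\<^esub> (inj2 X A B \<cdot> prj2 X A B)
           = ident X (A \<boxplus> B)"

context
  fixes X :: "('o, 'm, 'z) additive_cat_scheme" (structure)
begin

definition is_iso :: "'m \<Rightarrow> 'o \<Rightarrow> 'o \<Rightarrow> bool" where
  "is_iso b B B' \<longleftrightarrow> b \<in> carrier (Hom X B B') \<and>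
     (\<exists>b' \<in> carrier (Hom X B' B). b' \<cdot> b = ident X B \<and> b \<cdot> b' = ident X B')"

text \<open>The column $\binom{u}{v} : W \to A \oplus B$ and the row $(u, v) : A \oplus B \to W$.\<close>

definition col :: "'o \<Rightarrow> 'o \<Rightarrow> 'o \<Rightarrow> 'm \<Rightarrow> 'm \<Rightarrow> 'm" where
  "col W A B u v = (inj1 X A B \<cdot> u) \<oplus>\<^bsub>Hom X W (A \<boxplus> B)\<^esub> (inj2 X A B \<cdot> v)"

definition row :: "'o \<Rightarrow> 'o \<Rightarrow> 'o \<Rightarrow> 'm \<Rightarrow> 'm \<Rightarrow> 'm" where
  "row A B W u v = (u \<cdot> prj1 X A B) \<oplus>\<^bsub>Hom X (A \<boxplus> B) W\<^esub> (v \<cdot> prj2 X A B)"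

text \<open>The direct sum $f \oplus f' : A \oplus A' \to B \oplus B'$ of $f : A \to B$ and $f' : A' \to B'$.\<close>

definition msum :: "'o \<Rightarrow> 'o \<Rightarrow> 'o \<Rightarrow> 'o \<Rightarrow> 'm \<Rightarrow> 'm \<Rightarrow> 'm" where
  "msum A A' B B' f f' =
     row A A' (B \<boxplus> B') (inj1 X B B' \<cdot> f) (inj2 X B B' \<cdot> f')"

definition seqs :: "'o \<Rightarrow> 'o \<Rightarrow> ('o \<times> 'm \<times> 'm) set" where
  "seqs A C = {(B, x, y). B \<in> Obj X \<and> x \<in> carrier (Hom X A B) \<and> y \<in> carrier (Hom X B C)}"

definition seq_equiv :: "'o \<Rightarrow> 'o \<Rightarrow> (('o \<times> 'm \<times> 'm) \<times> ('o \<times> 'm \<times> 'm)) set" where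
  "seq_equiv A C =
     {((B, x, y), (B', x', y')). (B, x, y) \<in> seqs A C \<and> (B', x', y') \<in> seqs A C \<and>
        (\<exists>b. is_iso b B B' \<and> b \<cdot> x = x' \<and> y' \<cdot> b = y)}"

text \<open>The equivalence class $[A \xrightarrow{x} B \xrightarrow{y} C]$.\<close>

definition seq_class :: "'o \<Rightarrow> 'm \<Rightarrow> 'o \<Rightarrow> 'm \<Rightarrow> 'o \<Rightarrow> ('o \<times> 'm \<times> 'm) set" where
  "seq_class A x B y C = seq_equiv A C `` {(B, x, y)}"

end

lemma (in additive_category) equiv_seq_equiv:
  assumes A: "A \<in> Obj X" and C: "C \<in> Obj X"
  shows "equiv (seqs X A C) (seq_equiv X A C)"
proof (rule equivI)
  show "seq_equiv X A C \<subseteq> seqs X A C \<times> seqs X A C"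
    by (auto simp: seq_equiv_def)
  show "refl_on (seqs X A C) (seq_equiv X A C)"
  proof (rule refl_onI)
    fix s assume "s \<in> seqs X A C"
    then obtain B x y where s: "s = (B, x, y)" "B \<in> Obj X" "x \<in> carrier (Hom X A B)"
      "y \<in> carrier (Hom X B C)" by (auto simp: seqs_def)
    moreover have "is_iso X (ident X B) B B"
      using s cmp_ident_left[of B B "ident X B"] ident_closed by (auto simp: is_iso_def)
    ultimately show "(s, s) \<in> seq_equiv X A C"
      using A C by (auto simp: seq_equiv_def seqs_def cmp_ident_left cmp_ident_right
          intro!: exI[of _ "ident X B"])
  qed
  show "sym (seq_equiv X A C)"
  proof (rule symI)
    fix s t assume "(s, t) \<in> seq_equiv X A C"
    then obtain B x y B' x' y' b b' where *: "s = (B, x, y)" "t = (B', x', y')"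
      "B \<in> Obj X" "x \<in> carrier (Hom X A B)" "y \<in> carrier (Hom X B C)"
      "B' \<in> Obj X" "x' \<in> carrier (Hom X A B')" "y' \<in> carrier (Hom X B' C)"
      "b \<in> carrier (Hom X B B')" "b' \<in> carrier (Hom X B' B)" "b' \<cdot> b = ident X B"
      "b \<cdot> b' = ident X B'" "b \<cdot> x = x'" "y' \<cdot> b = y"
      by (auto simp: seq_equiv_def seqs_def is_iso_def)
    have "b' \<cdot> x' = x" using * A cmp_assoc[of A B B' B x b b'] by (simp add: cmp_ident_left)
    moreover have "y \<cdot> b' = y'" using * C cmp_assoc[of B' B B' C b' b y'] by (simp add: cmp_ident_right)
    ultimately show "(t, s) \<in> seq_equiv X A C"
      using * by (auto simp: seq_equiv_def seqs_def is_iso_def)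
  qed
  show "trans (seq_equiv X A C)"
  proof (rule transI)
    fix s t u assume "(s, t) \<in> seq_equiv X A C" "(t, u) \<in> seq_equiv X A C"
    then obtain B x y B' x' y' b b' B'' x'' y'' c c' where *: "s = (B, x, y)" "t = (B', x', y')"
      "u = (B'', x'', y'')"
      "B \<in> Obj X" "x \<in> carrier (Hom X A B)" "y \<in> carrier (Hom X B C)"
      "B' \<in> Obj X" "x' \<in> carrier (Hom X A B')" "y' \<in> carrier (Hom X B' C)"
      "B'' \<in> Obj X" "x'' \<in> carrier (Hom X A B'')" "y'' \<in> carrier (Hom X B'' C)"
      "b \<in> carrier (Hom X B B')" "b' \<in> carrier (Hom X B' B)" "b' \<cdot> b = ident X B"
      "b \<cdot> b' = ident X B'" "b \<cdot> x = x'" "y' \<cdot> b = y"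
      "c \<in> carrier (Hom X B' B'')" "c' \<in> carrier (Hom X B'' B')" "c' \<cdot> c = ident X B'"
      "c \<cdot> c' = ident X B''" "c \<cdot> x' = x''" "y'' \<cdot> c = y'"
      by (auto simp: seq_equiv_def seqs_def is_iso_def)
    have 1: "c \<cdot> b \<in> carrier (Hom X B B'')" "b' \<cdot> c' \<in> carrier (Hom X B'' B)"
      using * cmp_closed[of B B' B''] cmp_closed[of B'' B' B] by auto
    have "(b' \<cdot> c') \<cdot> (c \<cdot> b) = b' \<cdot> ((c' \<cdot> c) \<cdot> b)"
      using * 1 cmp_assoc[of B B'' B' B "c \<cdot> b" c' b'] cmp_assoc[of B B' B'' B' b c c'] by simp
    then have 2: "(b' \<cdot> c') \<cdot> (c \<cdot> b) = ident X B" using * by (simp add: cmp_ident_left)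
    have "(c \<cdot> b) \<cdot> (b' \<cdot> c') = c \<cdot> ((b \<cdot> b') \<cdot> c')"
      using * 1 cmp_assoc[of B'' B B' B'' "b' \<cdot> c'" b c] cmp_assoc[of B'' B' B B' c' b' b] by simp
    then have 3: "(c \<cdot> b) \<cdot> (b' \<cdot> c') = ident X B''" using * by (simp add: cmp_ident_left)
    have 4: "(c \<cdot> b) \<cdot> x = x''" using * A cmp_assoc[of A B B' B'' x b c] by simp
    have 5: "y'' \<cdot> (c \<cdot> b) = y" using * C cmp_assoc[of B B' B'' C b c y''] by simp
    show "(s, u) \<in> seq_equiv X A C"
      using * 1 2 3 4 5 by (auto simp: seq_equiv_def seqs_def is_iso_def)
  qed
qed


section \<open>Extensions\<close>

locale biadditive_functor = additive_category X
  for X :: "('o, 'm, 'e, 'z) ext_cat_scheme" (structure) +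
  assumes Ext_abelian_group: "\<lbrakk>C \<in> Obj X; A \<in> Obj X\<rbrakk> \<Longrightarrow> abelian_group (Ext X C A)"
    and Emap_hom:
      "\<lbrakk>C \<in> Obj X; C' \<in> Obj X; A \<in> Obj X; A' \<in> Obj X;
        c \<in> carrier (Hom X C' C); a \<in> carrier (Hom X A A')\<rbrakk>
       \<Longrightarrow> abelian_group_hom (Ext X C A) (Ext X C' A') (Emap X c a)"
    and Emap_ident:
      "\<lbrakk>C \<in> Obj X; A \<in> Obj X; \<delta> \<in> carrier (Ext X C A)\<rbrakk>
       \<Longrightarrow> Emap X (ident X C) (ident X A) \<delta> = \<delta>"
    and Emap_cmp:
      "\<lbrakk>C \<in> Obj X; C' \<in> Obj X; C'' \<in> Obj X; A \<in> Obj X; A' \<in> Obj X; A'' \<in> Obj X;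
        c \<in> carrier (Hom X C' C); c' \<in> carrier (Hom X C'' C');
        a \<in> carrier (Hom X A A'); a' \<in> carrier (Hom X A' A''); \<delta> \<in> carrier (Ext X C A)\<rbrakk>
       \<Longrightarrow> Emap X (c \<cdot> c') (a' \<cdot> a) \<delta> = Emap X c' a' (Emap X c a \<delta>)"
    and Emap_add_contravariant:
      "\<lbrakk>C \<in> Obj X; C' \<in> Obj X; A \<in> Obj X; c \<in> carrier (Hom X C' C); c' \<in> carrier (Hom X C' C);
        \<delta> \<in> carrier (Ext X C A)\<rbrakk>
       \<Longrightarrow> Emap X (c \<oplus>\<^bsub>Hom X C' C\<^esub> c') (ident X A) \<delta>
           = Emap X c (ident X A) \<delta> \<oplus>\<^bsub>Ext X C' A\<^esub> Emap X c' (ident X A) \<delta>"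
    and Emap_add_covariant:
      "\<lbrakk>C \<in> Obj X; A \<in> Obj X; A' \<in> Obj X; a \<in> carrier (Hom X A A'); a' \<in> carrier (Hom X A A');
        \<delta> \<in> carrier (Ext X C A)\<rbrakk>
       \<Longrightarrow> Emap X (ident X C) (a \<oplus>\<^bsub>Hom X A A'\<^esub> a') \<delta>
           = Emap X (ident X C) a \<delta> \<oplus>\<^bsub>Ext X C A'\<^esub> Emap X (ident X C) a' \<delta>"

context
  fixes X :: "('o, 'm, 'e, 'z) ext_cat_scheme" (structure)
begin

text \<open>
  For $\delta \in \mathbb{E}(C,A)$: \<open>push C a \<delta>\<close> is $a_*\delta$, and \<open>pull A c \<delta>\<close> is $c^*\delta$.
\<close>

definition push :: "'o \<Rightarrow> 'm \<Rightarrow> 'e \<Rightarrow> 'e" where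
  "push C a \<delta> = Emap X (ident X C) a \<delta>"

definition pull :: "'o \<Rightarrow> 'm \<Rightarrow> 'e \<Rightarrow> 'e" where
  "pull A c \<delta> = Emap X c (ident X A) \<delta>"

definition ext_morphism ::
  "'o \<Rightarrow> 'o \<Rightarrow> 'e \<Rightarrow> 'o \<Rightarrow> 'o \<Rightarrow> 'e \<Rightarrow> 'm \<Rightarrow> 'm \<Rightarrow> bool" where
  "ext_morphism C A \<delta> C' A' \<delta>' a c \<longleftrightarrow>
     a \<in> carrier (Hom X A A') \<and> c \<in> carrier (Hom X C C') \<and> push C a \<delta> = pull A' c \<delta>'"

text \<open>
  $\delta \oplus \delta'$ for $\delta \in \mathbb{E}(C,A)$ and $\delta' \in \mathbb{E}(C',A')$: the element
  whose four components under the isomorphism induced by the injections of $C \oplus C'$ and the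
  projections of $A \oplus A'$ are $\delta$, $0$, $0$, $\delta'$.
\<close>

definition ext_sum :: "'o \<Rightarrow> 'o \<Rightarrow> 'e \<Rightarrow> 'o \<Rightarrow> 'o \<Rightarrow> 'e \<Rightarrow> 'e" where
  "ext_sum C A \<delta> C' A' \<delta>' =
     (THE \<eta>. \<eta> \<in> carrier (Ext X (C \<boxplus> C') (A \<boxplus> A')) \<and>
        Emap X (inj1 X C C') (prj1 X A A') \<eta> = \<delta> \<and>
        Emap X (inj1 X C C') (prj2 X A A') \<eta> = \<zero>\<^bsub>Ext X C A'\<^esub> \<and>
        Emap X (inj2 X C C') (prj1 X A A') \<eta> = \<zero>\<^bsub>Ext X C' A\<^esub> \<and>
        Emap X (inj2 X C C') (prj2 X A A') \<eta> = \<delta>')"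

text \<open>\<open>E_triangle A x B y C \<delta>\<close>: $A \xrightarrow{x} B \xrightarrow{y} C$ is a sequence realizing
  $\delta \in \mathbb{E}(C,A)$.\<close>

definition E_triangle :: "'o \<Rightarrow> 'm \<Rightarrow> 'o \<Rightarrow> 'm \<Rightarrow> 'o \<Rightarrow> 'e \<Rightarrow> bool" where
  "E_triangle A x B y C \<delta> \<longleftrightarrow>
     A \<in> Obj X \<and> B \<in> Obj X \<and> C \<in> Obj X \<and>
     x \<in> carrier (Hom X A B) \<and> y \<in> carrier (Hom X B C) \<and>
     \<delta> \<in> carrier (Ext X C A) \<and> realize X C A \<delta> = seq_class X A x B y C"

definition inflation :: "'o \<Rightarrow> 'm \<Rightarrow> 'o \<Rightarrow> bool" where
  "inflation A x B \<longleftrightarrow> (\<exists>y C \<delta>. E_triangle A x B y C \<delta>)"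

definition E_triangle_morphism ::
  "'o \<Rightarrow> 'm \<Rightarrow> 'o \<Rightarrow> 'm \<Rightarrow> 'o \<Rightarrow> 'e \<Rightarrow> 'o \<Rightarrow> 'm \<Rightarrow> 'o \<Rightarrow> 'm \<Rightarrow> 'o \<Rightarrow> 'e \<Rightarrow>
   'm \<Rightarrow> 'm \<Rightarrow> 'm \<Rightarrow> bool" where
  "E_triangle_morphism A x B y C \<delta> A' x' B' y' C' \<delta>' a b c \<longleftrightarrow>
     E_triangle A x B y C \<delta> \<and> E_triangle A' x' B' y' C' \<delta>' \<and>
     a \<in> carrier (Hom X A A') \<and> b \<in> carrier (Hom X B B') \<and> c \<in> carrier (Hom X C C') \<and>
     b \<cdot> x = x' \<cdot> a \<and> y' \<cdot> b = c \<cdot> y \<and> push C a \<delta> = pull A' c \<delta>'"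

end

text \<open>The element described in \<open>ext_sum_def\<close> exists and is unique.\<close>

context biadditive_functor
begin

lemma Emap_closed:
  "\<lbrakk>C \<in> Obj X; C' \<in> Obj X; A \<in> Obj X; A' \<in> Obj X;
    c \<in> carrier (Hom X C' C); a \<in> carrier (Hom X A A'); \<delta> \<in> carrier (Ext X C A)\<rbrakk>
   \<Longrightarrow> Emap X c a \<delta> \<in> carrier (Ext X C' A')"
  using abelian_group_hom.hom_closed[OF Emap_hom] by blast

lemma Emap_add:
  "\<lbrakk>C \<in> Obj X; C' \<in> Obj X; A \<in> Obj X; A' \<in> Obj X;
    c \<in> carrier (Hom X C' C); a \<in> carrier (Hom X A A');
    \<delta> \<in> carrier (Ext X C A); \<epsilon> \<in> carrier (Ext X C A)\<rbrakk>
   \<Longrightarrow> Emap X c a (\<delta> \<oplus>\<^bsub>Ext X C A\<^esub> \<epsilon>)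
       = Emap X c a \<delta> \<oplus>\<^bsub>Ext X C' A'\<^esub> Emap X c a \<epsilon>"
  using abelian_group_hom.hom_add[OF Emap_hom] by blast

lemma Emap_add_left:
  assumes "C \<in> Obj X" "C' \<in> Obj X" "A \<in> Obj X" "A' \<in> Obj X"
    "c \<in> carrier (Hom X C' C)" "c' \<in> carrier (Hom X C' C)" "a \<in> carrier (Hom X A A')"
    "\<delta> \<in> carrier (Ext X C A)"
  shows "Emap X (c \<oplus>\<^bsub>Hom X C' C\<^esub> c') a \<delta>
         = Emap X c a \<delta> \<oplus>\<^bsub>Ext X C' A'\<^esub> Emap X c' a \<delta>"
proof -
  interpret H: abelian_group "Hom X C' C" by (rule Hom_abelian_group) (use assms in auto)
  have *: "Emap X k a \<delta> = Emap X (ident X C') a (Emap X k (ident X A) \<delta>)"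
    if "k \<in> carrier (Hom X C' C)" for k
    using Emap_cmp[of C C' C' A A A' k "ident X C'" "ident X A" a \<delta>] assms that
    by (simp add: ident_closed cmp_ident_right)
  have "Emap X (c \<oplus>\<^bsub>Hom X C' C\<^esub> c') a \<delta>
      = Emap X (ident X C') a (Emap X c (ident X A) \<delta> \<oplus>\<^bsub>Ext X C' A\<^esub> Emap X c' (ident X A) \<delta>)"
    using assms * Emap_add_contravariant by simp
  also have "\<dots> = Emap X (ident X C') a (Emap X c (ident X A) \<delta>)
      \<oplus>\<^bsub>Ext X C' A'\<^esub> Emap X (ident X C') a (Emap X c' (ident X A) \<delta>)"
    by (rule Emap_add) (use assms in \<open>auto intro!: Emap_closed[of C C' A A] ident_closed\<close>)
  finally show ?thesis using * assms by simp
qed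

lemma Emap_add_right:
  assumes "C \<in> Obj X" "C' \<in> Obj X" "A \<in> Obj X" "A' \<in> Obj X"
    "c \<in> carrier (Hom X C' C)" "a \<in> carrier (Hom X A A')" "a' \<in> carrier (Hom X A A')"
    "\<delta> \<in> carrier (Ext X C A)"
  shows "Emap X c (a \<oplus>\<^bsub>Hom X A A'\<^esub> a') \<delta>
         = Emap X c a \<delta> \<oplus>\<^bsub>Ext X C' A'\<^esub> Emap X c a' \<delta>"
proof -
  interpret H: abelian_group "Hom X A A'" by (rule Hom_abelian_group) (use assms in auto)
  have *: "Emap X c k \<delta> = Emap X c (ident X A') (Emap X (ident X C) k \<delta>)"
    if "k \<in> carrier (Hom X A A')" for k
    using Emap_cmp[of C C C' A A' A' "ident X C" c k "ident X A'" \<delta>] assms that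
    by (simp add: ident_closed cmp_ident_left)
  have "Emap X c (a \<oplus>\<^bsub>Hom X A A'\<^esub> a') \<delta>
      = Emap X c (ident X A') (Emap X (ident X C) a \<delta> \<oplus>\<^bsub>Ext X C A'\<^esub> Emap X (ident X C) a' \<delta>)"
    using assms * Emap_add_covariant by simp
  also have "\<dots> = Emap X c (ident X A') (Emap X (ident X C) a \<delta>)
      \<oplus>\<^bsub>Ext X C' A'\<^esub> Emap X c (ident X A') (Emap X (ident X C) a' \<delta>)"
    by (rule Emap_add) (use assms in \<open>auto intro!: Emap_closed[of C C A A'] ident_closed\<close>)
  finally show ?thesis using * assms by simp
qed

lemma Emap_zero_left:
  assumes "C \<in> Obj X" "C' \<in> Obj X" "A \<in> Obj X" "A' \<in> Obj X"
    "a \<in> carrier (Hom X A A')" "\<delta> \<in> carrier (Ext X C A)"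
  shows "Emap X \<zero>\<^bsub>Hom X C' C\<^esub> a \<delta> = \<zero>\<^bsub>Ext X C' A'\<^esub>"
proof -
  interpret H: abelian_group "Hom X C' C" by (rule Hom_abelian_group) (use assms in auto)
  interpret E: abelian_group "Ext X C' A'" by (rule Ext_abelian_group) (use assms in auto)
  show ?thesis
    using Emap_add_left[of C C' A A' "\<zero>\<^bsub>Hom X C' C\<^esub>" "\<zero>\<^bsub>Hom X C' C\<^esub>" a \<delta>] assms
      Emap_closed[of C C' A A' "\<zero>\<^bsub>Hom X C' C\<^esub>" a \<delta>] by simp
qed

lemma Emap_zero_right:
  assumes "C \<in> Obj X" "C' \<in> Obj X" "A \<in> Obj X" "A' \<in> Obj X"
    "c \<in> carrier (Hom X C' C)" "\<delta> \<in> carrier (Ext X C A)"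
  shows "Emap X c \<zero>\<^bsub>Hom X A A'\<^esub> \<delta> = \<zero>\<^bsub>Ext X C' A'\<^esub>"
proof -
  interpret H: abelian_group "Hom X A A'" by (rule Hom_abelian_group) (use assms in auto)
  interpret E: abelian_group "Ext X C' A'" by (rule Ext_abelian_group) (use assms in auto)
  show ?thesis
    using Emap_add_right[of C C' A A' c "\<zero>\<^bsub>Hom X A A'\<^esub>" "\<zero>\<^bsub>Hom X A A'\<^esub>" \<delta>] assms
      Emap_closed[of C C' A A' c "\<zero>\<^bsub>Hom X A A'\<^esub>" \<delta>] by simp
qed

lemma ext_sum_unique_existence:
  assumes obj: "C \<in> Obj X" "C' \<in> Obj X" "A \<in> Obj X" "A' \<in> Obj X"
    and \<delta>: "\<delta> \<in> carrier (Ext X C A)" and \<delta>': "\<delta>' \<in> carrier (Ext X C' A')"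
  shows "\<exists>!\<eta>. \<eta> \<in> carrier (Ext X (C \<boxplus> C') (A \<boxplus> A')) \<and>
        Emap X (inj1 X C C') (prj1 X A A') \<eta> = \<delta> \<and>
        Emap X (inj1 X C C') (prj2 X A A') \<eta> = \<zero>\<^bsub>Ext X C A'\<^esub> \<and>
        Emap X (inj2 X C C') (prj1 X A A') \<eta> = \<zero>\<^bsub>Ext X C' A\<^esub> \<and>
        Emap X (inj2 X C C') (prj2 X A A') \<eta> = \<delta>'"
proof -
  let ?S = "C \<boxplus> C'" and ?T = "A \<boxplus> A'"
  let ?E = "Ext X ?S ?T"
  let ?\<eta> = "Emap X (prj1 X C C') (inj1 X A A') \<delta> \<oplus>\<^bsub>?E\<^esub> Emap X (prj2 X C C') (inj2 X A A') \<delta>'"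
  note cl = obj dsum_closed inj1_closed inj2_closed prj1_closed prj2_closed ident_closed cmp_closed
  interpret E: abelian_group ?E by (rule Ext_abelian_group) (use cl in auto)
  interpret E11: abelian_group "Ext X C A" by (rule Ext_abelian_group) (use cl in auto)
  interpret E12: abelian_group "Ext X C A'" by (rule Ext_abelian_group) (use cl in auto)
  interpret E21: abelian_group "Ext X C' A" by (rule Ext_abelian_group) (use cl in auto)
  interpret E22: abelian_group "Ext X C' A'" by (rule Ext_abelian_group) (use cl in auto)
  have zc: "\<zero>\<^bsub>Hom X P Q\<^esub> \<in> carrier (Hom X P Q)" if "P \<in> Obj X" "Q \<in> Obj X" for P Q
    using abelian_monoid.zero_closed[OF abelian_group.axioms(1)[OF Hom_abelian_group]] that by blast
  have comp1: "Emap X i q (Emap X (prj1 X C C') (inj1 X A A') \<delta>)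
      = Emap X (prj1 X C C' \<cdot> i) (q \<cdot> inj1 X A A') \<delta>"
    if "P \<in> Obj X" "Q \<in> Obj X" "i \<in> carrier (Hom X P ?S)" "q \<in> carrier (Hom X ?T Q)" for P Q i q
    using Emap_cmp[of C ?S P A ?T Q "prj1 X C C'" i "inj1 X A A'" q \<delta>] that cl \<delta> by simp
  have comp2: "Emap X i q (Emap X (prj2 X C C') (inj2 X A A') \<delta>')
      = Emap X (prj2 X C C' \<cdot> i) (q \<cdot> inj2 X A A') \<delta>'"
    if "P \<in> Obj X" "Q \<in> Obj X" "i \<in> carrier (Hom X P ?S)" "q \<in> carrier (Hom X ?T Q)" for P Q i q
    using Emap_cmp[of C' ?S P A' ?T Q "prj2 X C C'" i "inj2 X A A'" q \<delta>'] that cl \<delta>' by simp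
  have c1: "Emap X (prj1 X C C') (inj1 X A A') \<delta> \<in> carrier ?E"
    by (rule Emap_closed[of C _ A]) (use cl \<delta> in auto)
  have c2: "Emap X (prj2 X C C') (inj2 X A A') \<delta>' \<in> carrier ?E"
    by (rule Emap_closed[of C' _ A']) (use cl \<delta>' in auto)
  have split: "Emap X i q ?\<eta> = Emap X (prj1 X C C' \<cdot> i) (q \<cdot> inj1 X A A') \<delta>
      \<oplus>\<^bsub>Ext X P Q\<^esub> Emap X (prj2 X C C' \<cdot> i) (q \<cdot> inj2 X A A') \<delta>'"
    if "P \<in> Obj X" "Q \<in> Obj X" "i \<in> carrier (Hom X P ?S)" "q \<in> carrier (Hom X ?T Q)" for P Q i q
    using Emap_add[of ?S P ?T Q i q, OF _ _ _ _ _ _ c1 c2] that cl comp1 comp2 by simp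
  note eqs = prj1_inj1 prj2_inj2 prj1_inj2 prj2_inj1 Emap_ident Emap_zero_left Emap_zero_right zc
  have ex: "?\<eta> \<in> carrier ?E" "Emap X (inj1 X C C') (prj1 X A A') ?\<eta> = \<delta>"
      "Emap X (inj1 X C C') (prj2 X A A') ?\<eta> = \<zero>\<^bsub>Ext X C A'\<^esub>"
      "Emap X (inj2 X C C') (prj1 X A A') ?\<eta> = \<zero>\<^bsub>Ext X C' A\<^esub>"
      "Emap X (inj2 X C C') (prj2 X A A') ?\<eta> = \<delta>'"
  proof -
    show "?\<eta> \<in> carrier ?E" using c1 c2 by simp
    show "Emap X (inj1 X C C') (prj1 X A A') ?\<eta> = \<delta>"
      using split[of C A] cl \<delta> \<delta>' by (simp add: eqs)
    show "Emap X (inj1 X C C') (prj2 X A A') ?\<eta> = \<zero>\<^bsub>Ext X C A'\<^esub>"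
      using split[of C A'] cl \<delta> \<delta>' 
      by (simp add: eqs)
    show "Emap X (inj2 X C C') (prj1 X A A') ?\<eta> = \<zero>\<^bsub>Ext X C' A\<^esub>"
      using split[of C' A] cl \<delta> \<delta>' 
      by (simp add: eqs)
    show "Emap X (inj2 X C C') (prj2 X A A') ?\<eta> = \<delta>'"
      using split[of C' A'] cl \<delta> \<delta>' by (simp add: eqs)
  qed
  have decomp: "\<eta> =
      (Emap X (prj1 X C C') (inj1 X A A') (Emap X (inj1 X C C') (prj1 X A A') \<eta>) \<oplus>\<^bsub>?E\<^esub>
       Emap X (prj1 X C C') (inj2 X A A') (Emap X (inj1 X C C') (prj2 X A A') \<eta>)) \<oplus>\<^bsub>?E\<^esub>
      (Emap X (prj2 X C C') (inj1 X A A') (Emap X (inj2 X C C') (prj1 X A A') \<eta>) \<oplus>\<^bsub>?E\<^esub>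
       Emap X (prj2 X C C') (inj2 X A A') (Emap X (inj2 X C C') (prj2 X A A') \<eta>))"
    if \<eta>: "\<eta> \<in> carrier ?E" for \<eta>
  proof -
    have S: "?S \<in> Obj X" and T: "?T \<in> Obj X" using cl by auto
    have i: "inj1 X C C' \<cdot> prj1 X C C' \<in> carrier (Hom X ?S ?S)"
      "inj2 X C C' \<cdot> prj2 X C C' \<in> carrier (Hom X ?S ?S)"
      using cl cmp_closed[of ?S C ?S] cmp_closed[of ?S C' ?S] by auto
    have j: "inj1 X A A' \<cdot> prj1 X A A' \<in> carrier (Hom X ?T ?T)"
      "inj2 X A A' \<cdot> prj2 X A A' \<in> carrier (Hom X ?T ?T)"
      using cl cmp_closed[of ?T A ?T] cmp_closed[of ?T A' ?T] by auto
    have "\<eta> = Emap X (ident X ?S) (ident X ?T) \<eta>" using \<eta> S T by (simp add: Emap_ident)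
    also have "\<dots> = Emap X (inj1 X C C' \<cdot> prj1 X C C') (ident X ?T) \<eta>
        \<oplus>\<^bsub>?E\<^esub> Emap X (inj2 X C C' \<cdot> prj2 X C C') (ident X ?T) \<eta>"
      using Emap_add_left[OF S S T T i ident_closed[OF T] \<eta>] inj_prj_sum[of C C'] obj by simp
    also have "\<dots> = (Emap X (inj1 X C C' \<cdot> prj1 X C C') (inj1 X A A' \<cdot> prj1 X A A') \<eta>
         \<oplus>\<^bsub>?E\<^esub> Emap X (inj1 X C C' \<cdot> prj1 X C C') (inj2 X A A' \<cdot> prj2 X A A') \<eta>)
       \<oplus>\<^bsub>?E\<^esub> (Emap X (inj2 X C C' \<cdot> prj2 X C C') (inj1 X A A' \<cdot> prj1 X A A') \<eta>
         \<oplus>\<^bsub>?E\<^esub> Emap X (inj2 X C C' \<cdot> prj2 X C C') (inj2 X A A' \<cdot> prj2 X A A') \<eta>)"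
      using Emap_add_right[OF S S T T i(1) j \<eta>] Emap_add_right[OF S S T T i(2) j \<eta>]
        inj_prj_sum[of A A'] obj by simp
    finally show ?thesis
      using Emap_cmp[of ?S C ?S ?T A ?T "inj1 X C C'" "prj1 X C C'" "prj1 X A A'" "inj1 X A A'" \<eta>]
        Emap_cmp[of ?S C ?S ?T A' ?T "inj1 X C C'" "prj1 X C C'" "prj2 X A A'" "inj2 X A A'" \<eta>]
        Emap_cmp[of ?S C' ?S ?T A ?T "inj2 X C C'" "prj2 X C C'" "prj1 X A A'" "inj1 X A A'" \<eta>]
        Emap_cmp[of ?S C' ?S ?T A' ?T "inj2 X C C'" "prj2 X C C'" "prj2 X A A'" "inj2 X A A'" \<eta>]
        cl \<eta> by simp
  qed
  show ?thesis
    by (rule ex1I[of _ ?\<eta>], use ex in blast) (metis decomp ex)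
qed

end


section \<open>Pre-extriangulated categories\<close>

locale additive_realization = biadditive_functor X
  for X :: "('o, 'm, 'e, 'z) ext_cat_scheme" (structure) +
  assumes realize_class:
      "\<lbrakk>C \<in> Obj X; A \<in> Obj X; \<delta> \<in> carrier (Ext X C A)\<rbrakk>
       \<Longrightarrow> realize X C A \<delta> \<in> seqs X A C // seq_equiv X A C"
    and realize_morphism:
      "\<lbrakk>E_triangle X A x B y C \<delta>; E_triangle X A' x' B' y' C' \<delta>';
        ext_morphism X C A \<delta> C' A' \<delta>' a c\<rbrakk>
       \<Longrightarrow> \<exists>b \<in> carrier (Hom X B B'). b \<cdot> x = x' \<cdot> a \<and> y' \<cdot> b = c \<cdot> y"
    and realize_zero:
      "\<lbrakk>C \<in> Obj X; A \<in> Obj X\<rbrakk>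
       \<Longrightarrow> realize X C A \<zero>\<^bsub>Ext X C A\<^esub>
           = seq_class X A (col X A A C (ident X A) \<zero>\<^bsub>Hom X A C\<^esub>) (A \<boxplus> C)
                         (row X A C C \<zero>\<^bsub>Hom X A C\<^esub> (ident X C)) C"
    and realize_sum:
      "\<lbrakk>E_triangle X A x B y C \<delta>; E_triangle X A' x' B' y' C' \<delta>'\<rbrakk>
       \<Longrightarrow> realize X (C \<boxplus> C') (A \<boxplus> A') (ext_sum X C A \<delta> C' A' \<delta>')
           = seq_class X (A \<boxplus> A') (msum X A A' B B' x x') (B \<boxplus> B')
                         (msum X B B' C C' y y') (C \<boxplus> C')"

locale pre_extriangulated = additive_realization X
  for X :: "('o, 'm, 'e, 'z) ext_cat_scheme" (structure) +
  assumes ET3: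
      "\<lbrakk>E_triangle X A x B y C \<delta>; E_triangle X A' x' B' y' C' \<delta>';
        a \<in> carrier (Hom X A A'); b \<in> carrier (Hom X B B'); b \<cdot> x = x' \<cdot> a\<rbrakk>
       \<Longrightarrow> \<exists>c. E_triangle_morphism X A x B y C \<delta> A' x' B' y' C' \<delta>' a b c"
    and ET3_op:
      "\<lbrakk>E_triangle X A x B y C \<delta>; E_triangle X A' x' B' y' C' \<delta>';
        b \<in> carrier (Hom X B B'); c \<in> carrier (Hom X C C'); y' \<cdot> b = c \<cdot> y\<rbrakk>
       \<Longrightarrow> \<exists>a. E_triangle_morphism X A x B y C \<delta> A' x' B' y' C' \<delta>' a b c"


section \<open>The conditions\<close>

context
  fixes X :: "('o, 'm, 'e, 'z) ext_cat_scheme" (structure)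
begin

definition ET0 :: bool where
  "ET0 \<longleftrightarrow>
     (\<forall>A B C f g. inflation X A f B \<and> inflation X B g C \<longrightarrow> inflation X A (g \<cdot> f) C)"

definition ET4 :: bool where
  "ET4 \<longleftrightarrow>
     (\<forall>A f B f' D \<delta> g C g' F \<delta>'.
        E_triangle X A f B f' D \<delta> \<and> E_triangle X B g C g' F \<delta>' \<longrightarrow>
        (\<exists>E h h' \<delta>'' d e.
           E_triangle X A h C h' E \<delta>'' \<and> E_triangle X D d E e F (push X F f' \<delta>') \<and>
           h = g \<cdot> f \<and> d \<cdot> f' = h' \<cdot> g \<and> e \<cdot> h' = g' \<and>
           pull X A d \<delta>'' = \<delta> \<and> push X E f \<delta>'' = pull X B e \<delta>'))"

definition ET4_1 :: bool where
  "ET4_1 \<longleftrightarrow>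
     (\<forall>A\<^sub>1 x\<^sub>1 B\<^sub>1 y\<^sub>1 A\<^sub>2 x\<^sub>2 B\<^sub>2 y\<^sub>2 C \<delta>\<^sub>1 \<delta>\<^sub>2.
        E_triangle X A\<^sub>1 x\<^sub>1 B\<^sub>1 y\<^sub>1 C \<delta>\<^sub>1 \<and> E_triangle X A\<^sub>2 x\<^sub>2 B\<^sub>2 y\<^sub>2 C \<delta>\<^sub>2 \<longrightarrow>
        (\<exists>M m\<^sub>1 e\<^sub>1 m\<^sub>2 e\<^sub>2.
           E_triangle X A\<^sub>1 m\<^sub>1 M e\<^sub>1 B\<^sub>2 (pull X A\<^sub>1 y\<^sub>2 \<delta>\<^sub>1) \<and>
           E_triangle X A\<^sub>2 m\<^sub>2 M e\<^sub>2 B\<^sub>1 (pull X A\<^sub>2 y\<^sub>1 \<delta>\<^sub>2) \<and>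
           e\<^sub>2 \<cdot> m\<^sub>1 = x\<^sub>1 \<and> e\<^sub>1 \<cdot> m\<^sub>2 = x\<^sub>2 \<and> y\<^sub>2 \<cdot> e\<^sub>1 = y\<^sub>1 \<cdot> e\<^sub>2 \<and>
           push X C m\<^sub>1 \<delta>\<^sub>1 \<oplus>\<^bsub>Ext X C M\<^esub> push X C m\<^sub>2 \<delta>\<^sub>2 = \<zero>\<^bsub>Ext X C M\<^esub>))"

definition ET4_2 :: bool where
  "ET4_2 \<longleftrightarrow>
     (\<forall>A x B y C \<delta> D f d E e.
        E_triangle X A x B y C \<delta> \<and> D \<in> Obj X \<and> f \<in> carrier (Hom X A D) \<and>
        E_triangle X D d E e C (push X C f \<delta>) \<longrightarrow>
        (\<exists>g. E_triangle_morphism X A x B y C \<delta> D d E e C (push X C f \<delta>) f g (ident X C) \<and>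
             E_triangle X A (col X A D B (\<ominus>\<^bsub>Hom X A D\<^esub> f) x) (D \<boxplus> B) (row X D B E d g) E
                          (pull X A e \<delta>)))"

definition ET4_3 :: bool where
  "ET4_3 \<longleftrightarrow>
     (\<forall>A f B f' D \<delta>\<^sub>f g C g' F \<delta>\<^sub>g h h\<^sub>0 E\<^sub>0 \<delta>\<^sub>h.
        E_triangle X A f B f' D \<delta>\<^sub>f \<and> E_triangle X B g C g' F \<delta>\<^sub>g \<and>
        E_triangle X A h C h\<^sub>0 E\<^sub>0 \<delta>\<^sub>h \<and> h = g \<cdot> f \<longrightarrow>
        (\<exists>d\<^sub>0 \<in> carrier (Hom X D E\<^sub>0). \<exists>e\<^sub>0 \<in> carrier (Hom X E\<^sub>0 F).
           d\<^sub>0 \<cdot> f' = h\<^sub>0 \<cdot> g \<and> e\<^sub>0 \<cdot> h\<^sub>0 = g' \<and>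
           E_triangle X D d\<^sub>0 E\<^sub>0 e\<^sub>0 F (push X F f' \<delta>\<^sub>g) \<and>
           pull X A d\<^sub>0 \<delta>\<^sub>h = \<delta>\<^sub>f \<and> push X E\<^sub>0 f \<delta>\<^sub>h = pull X B e\<^sub>0 \<delta>\<^sub>g))"

definition ET4_5 :: bool where
  "ET4_5 \<longleftrightarrow>
     (\<forall>A\<^sub>1 x\<^sub>1 B\<^sub>1 y\<^sub>1 A\<^sub>2 x\<^sub>2 B\<^sub>2 y\<^sub>2 C \<delta> \<delta>' g.
        E_triangle X A\<^sub>1 x\<^sub>1 B\<^sub>1 y\<^sub>1 C \<delta> \<and> E_triangle X A\<^sub>2 x\<^sub>2 B\<^sub>2 y\<^sub>2 C \<delta>' \<and>
        g \<in> carrier (Hom X B\<^sub>1 B\<^sub>2) \<and> y\<^sub>2 \<cdot> g = y\<^sub>1 \<longrightarrow>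
        (\<exists>f. E_triangle_morphism X A\<^sub>1 x\<^sub>1 B\<^sub>1 y\<^sub>1 C \<delta> A\<^sub>2 x\<^sub>2 B\<^sub>2 y\<^sub>2 C \<delta>' f g (ident X C) \<and>
             E_triangle X A\<^sub>1 (col X A\<^sub>1 A\<^sub>2 B\<^sub>1 (\<ominus>\<^bsub>Hom X A\<^sub>1 A\<^sub>2\<^esub> f) x\<^sub>1) (A\<^sub>2 \<boxplus> B\<^sub>1)
                          (row X A\<^sub>2 B\<^sub>1 B\<^sub>2 x\<^sub>2 g) B\<^sub>2 (pull X A\<^sub>1 y\<^sub>2 \<delta>)))"

end

end

theory Submission
  imports Defs
begin

text \<open>
  The five conditions are five forms of the octahedral axiom, and the equivalences follow from one
  cycle: (ET4) implies (ET0) and (ET4-1); (ET4-1) implies (ET4-5), (ET4-5) implies (ET4-2), and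
  (ET4-2) implies (ET4-3); finally (ET4-3) and (ET0) together give (ET4), since (ET0) supplies the
  triangle over \<open>g \<cdot> f\<close> that (ET4-3) takes as given.

  Two tools from the axioms of a pre-extriangulated category are used throughout. The first is
  exactness of the Hom-Ext sequences of a triangle, obtained by comparing the triangle with split
  ones. The second is uniqueness: the middle term, and for a fixed inflation the cone, are
  determined up to isomorphism. For both, a composite \<open>u\<close> of two comparison morphisms satisfies
  $(u - 1)^2 = 0$ and is therefore invertible, which takes the place of a five lemma
  (\<open>sequence_endomorphism_iso\<close>, \<open>cone_unique\<close>).

  From (ET4) to (ET4-1): realize $\nu = (\delta_1, \delta_2) \in \mathbb{E}(C, A_1 \oplus A_2)$
  by $A_1 \oplus A_2 \to M \to C$ and apply (ET4) to each inclusion $A_i \to A_1 \oplus A_2$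
  followed by $A_1 \oplus A_2 \to M$.

  From (ET4-1) to (ET4-5): if \<open>y\<^sub>1\<close> factors through \<open>y\<^sub>2\<close>, then $y_1^*\delta' = 0$, so the object
  \<open>M\<close> of (ET4-1) is $A_2 \oplus B_1$. What is left is to correct the components of the
  resulting maps by shear automorphisms (\<open>E_triangle_shear\<close>); the same correction leads from
  (ET4-5) to (ET4-2).

  From (ET4-2) to (ET4-3): by (ET4-2) the pushout of \<open>g\<close> along \<open>f'\<close> gives a triangle
  $B \to D \oplus C \to E$ with inflation $\binom{-f'}{g}$, where $D \to E \to F$ realizes
  $f'_*\delta_g$. By \<open>ET4_2_cobase_change\<close> there is also a triangle
  $B \to D \oplus C \to E_0$ with the same inflation. By uniqueness of cones $E_0 \cong E$, and
  carrying $D \to E \to F$ along this isomorphism gives the triangle sought.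
\<close>

section \<open>Arrows with source and target\<close>

context additive_category
begin

text \<open>
  Reading off source and target from a morphism, and extending the additions of all Hom groups to
  one operation, removes the objects from the arguments of addition and negation. The typing conditions of the
  rewrite rules below then contain only variables of the redex, so that the simplifier decides
  them.
\<close>

definition arr :: "'m \<Rightarrow> bool" where
  "arr f \<longleftrightarrow> (\<exists>A \<in> Obj X. \<exists>B \<in> Obj X. f \<in> carrier (Hom X A B))"

definition src :: "'m \<Rightarrow> 'o" where
  "src f = (THE A. A \<in> Obj X \<and> (\<exists>B \<in> Obj X. f \<in> carrier (Hom X A B)))"

definition tgt :: "'m \<Rightarrow> 'o" where
  "tgt f = (THE B. B \<in> Obj X \<and> (\<exists>A \<in> Obj X. f \<in> carrier (Hom X A B)))"

definition add_arr :: "'m \<Rightarrow> 'm \<Rightarrow> 'm" (infixl \<open>\<^bold>+\<close> 65) where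
  "f \<^bold>+ g = f \<oplus>\<^bsub>Hom X (src f) (tgt f)\<^esub> g"

definition neg_arr :: "'m \<Rightarrow> 'm" (\<open>\<^bold>- _\<close> [80] 80) where
  "\<^bold>- f = \<ominus>\<^bsub>Hom X (src f) (tgt f)\<^esub> f"

lemma Hom_iff_arr [simp]:
  assumes "A \<in> Obj X" "B \<in> Obj X"
  shows "f \<in> carrier (Hom X A B) \<longleftrightarrow> arr f \<and> src f = A \<and> tgt f = B"
proof -
  have "src f = A'" "tgt f = B'"
    if "A' \<in> Obj X" "B' \<in> Obj X" "f \<in> carrier (Hom X A' B')" for A' B'
    using that unfolding src_def tgt_def
    by (auto intro!: the_equality dest: Hom_disjoint[of A' B'])
  then show ?thesis using assms unfolding arr_def by metis
qed

lemma src_Obj [simp]: "arr f \<Longrightarrow> src f \<in> Obj X"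
  and tgt_Obj [simp]: "arr f \<Longrightarrow> tgt f \<in> Obj X"
  unfolding arr_def by auto

lemma add_Hom [simp]:
  "\<lbrakk>arr f; src f = A; tgt f = B\<rbrakk> \<Longrightarrow> f \<oplus>\<^bsub>Hom X A B\<^esub> g = f \<^bold>+ g"
  by (simp add: add_arr_def)

lemma neg_Hom [simp]:
  "\<lbrakk>arr f; src f = A; tgt f = B\<rbrakk> \<Longrightarrow> \<ominus>\<^bsub>Hom X A B\<^esub> f = \<^bold>- f"
  by (simp add: neg_arr_def)

lemma zero_arr [simp]:
  assumes "A \<in> Obj X" "B \<in> Obj X"
  shows "arr \<zero>\<^bsub>Hom X A B\<^esub>" "src \<zero>\<^bsub>Hom X A B\<^esub> = A" "tgt \<zero>\<^bsub>Hom X A B\<^esub> = B"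
  using abelian_monoid.zero_closed[OF abelian_group.axioms(1)[OF Hom_abelian_group[OF assms]]] assms
  by auto

lemma ident_arr [simp]:
  assumes "A \<in> Obj X"
  shows "arr (ident X A)" "src (ident X A) = A" "tgt (ident X A) = A"
  using ident_closed[OF assms] assms by auto

lemma cmp_arr [simp]:
  assumes "arr f" "arr g" "tgt f = src g"
  shows "arr (g \<cdot> f)" "src (g \<cdot> f) = src f" "tgt (g \<cdot> f) = tgt g"
  using cmp_closed[of "src f" "tgt f" "tgt g" f g] assms by auto

lemma add_arr [simp]:
  assumes "arr f" "arr g" "src g = src f" "tgt g = tgt f"
  shows "arr (f \<^bold>+ g)" "src (f \<^bold>+ g) = src f" "tgt (f \<^bold>+ g) = tgt f"
proof -
  interpret H: abelian_group "Hom X (src f) (tgt f)" by (rule Hom_abelian_group) (use assms in auto)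
  have "f \<^bold>+ g \<in> carrier (Hom X (src f) (tgt f))"
    unfolding add_arr_def using assms by (intro H.add.m_closed) auto
  then show "arr (f \<^bold>+ g)" "src (f \<^bold>+ g) = src f" "tgt (f \<^bold>+ g) = tgt f" using assms by auto
qed

lemma neg_arr [simp]:
  assumes "arr f"
  shows "arr (\<^bold>- f)" "src (\<^bold>- f) = src f" "tgt (\<^bold>- f) = tgt f"
proof -
  interpret H: abelian_group "Hom X (src f) (tgt f)" by (rule Hom_abelian_group) (use assms in auto)
  have "\<^bold>- f \<in> carrier (Hom X (src f) (tgt f))"
    unfolding neg_arr_def using assms by (intro H.a_inv_closed) auto
  then show "arr (\<^bold>- f)" "src (\<^bold>- f) = src f" "tgt (\<^bold>- f) = tgt f" using assms by auto
qed

declare dsum_closed [simp]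

lemma inj_prj_arr [simp]:
  assumes "A \<in> Obj X" "B \<in> Obj X"
  shows "arr (inj1 X A B)" "src (inj1 X A B) = A" "tgt (inj1 X A B) = A \<boxplus> B"
    "arr (inj2 X A B)" "src (inj2 X A B) = B" "tgt (inj2 X A B) = A \<boxplus> B"
    "arr (prj1 X A B)" "src (prj1 X A B) = A \<boxplus> B" "tgt (prj1 X A B) = A"
    "arr (prj2 X A B)" "src (prj2 X A B) = A \<boxplus> B" "tgt (prj2 X A B) = B"
  using inj1_closed inj2_closed prj1_closed prj2_closed assms by auto

lemma cmp_ident [simp]:
  "arr f \<Longrightarrow> tgt f = B \<Longrightarrow> ident X B \<cdot> f = f"
  "arr f \<Longrightarrow> src f = A \<Longrightarrow> f \<cdot> ident X A = f"
  using cmp_ident_left[of "src f" "tgt f" f] cmp_ident_right[of "src f" "tgt f" f] by auto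

lemma cmp_cmp [simp]:
  "\<lbrakk>arr f; arr g; arr h; tgt f = src g; tgt g = src h\<rbrakk> \<Longrightarrow> (h \<cdot> g) \<cdot> f = h \<cdot> (g \<cdot> f)"
  using cmp_assoc[of "src f" "tgt f" "tgt g" "tgt h" f g h] by auto

text \<open>With compositions nested to the right, an equation \<open>g \<cdot> f = k\<close> has to be available in
  this prolonged form to rewrite inside a longer composition.\<close>

lemma cmp_prolong:
  "\<lbrakk>g \<cdot> f = k; arr f; arr g; arr w; tgt w = src f; tgt f = src g\<rbrakk> \<Longrightarrow> g \<cdot> (f \<cdot> w) = k \<cdot> w"
  by (metis cmp_cmp)

lemma cmp_add [simp]:
  "\<lbrakk>arr f; arr g; arr g'; tgt f = src g; src g' = src g; tgt g' = tgt g\<rbrakk>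
   \<Longrightarrow> (g \<^bold>+ g') \<cdot> f = g \<cdot> f \<^bold>+ g' \<cdot> f"
  "\<lbrakk>arr f; arr f'; arr g; tgt f = src g; src f' = src f; tgt f' = tgt f\<rbrakk>
   \<Longrightarrow> g \<cdot> (f \<^bold>+ f') = g \<cdot> f \<^bold>+ g \<cdot> f'"
  using cmp_add_left[of "src f" "tgt f" "tgt g" f g g']
    cmp_add_right[of "src f" "tgt f" "tgt g" f f' g] by auto

lemma add_arr_assoc:
  assumes "arr f" "arr g" "arr h" "src g = src f" "tgt g = tgt f" "src h = src f" "tgt h = tgt f"
  shows "(f \<^bold>+ g) \<^bold>+ h = f \<^bold>+ (g \<^bold>+ h)"
proof -
  interpret H: abelian_group "Hom X (src f) (tgt f)" by (rule Hom_abelian_group) (use assms in auto)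
  have c: "f \<in> carrier (Hom X (src f) (tgt f))" "g \<in> carrier (Hom X (src f) (tgt f))"
    "h \<in> carrier (Hom X (src f) (tgt f))" using assms by auto
  show ?thesis using H.a_assoc[OF c] assms by simp
qed

lemma add_arr_commute:
  assumes "arr f" "arr g" "src g = src f" "tgt g = tgt f"
  shows "f \<^bold>+ g = g \<^bold>+ f"
proof -
  interpret H: abelian_group "Hom X (src f) (tgt f)" by (rule Hom_abelian_group) (use assms in auto)
  show ?thesis using H.a_comm[of f g] assms by simp
qed

lemma add_neg_arr [simp]:
  assumes "arr f"
  shows "f \<^bold>+ \<^bold>- f = \<zero>\<^bsub>Hom X (src f) (tgt f)\<^esub>" "\<^bold>- f \<^bold>+ f = \<zero>\<^bsub>Hom X (src f) (tgt f)\<^esub>"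
    "\<^bold>- \<^bold>- f = f"
proof -
  interpret H: abelian_group "Hom X (src f) (tgt f)" by (rule Hom_abelian_group) (use assms in auto)
  show "f \<^bold>+ \<^bold>- f = \<zero>\<^bsub>Hom X (src f) (tgt f)\<^esub>" using H.r_neg[of f] assms by simp
  show "\<^bold>- f \<^bold>+ f = \<zero>\<^bsub>Hom X (src f) (tgt f)\<^esub>" using H.l_neg[of f] assms by simp
  show "\<^bold>- \<^bold>- f = f" using H.minus_minus[of f] assms by simp
qed

lemma add_zero_arr [simp]:
  assumes "arr f" "src f = A" "tgt f = B"
  shows "f \<^bold>+ \<zero>\<^bsub>Hom X A B\<^esub> = f" "\<zero>\<^bsub>Hom X A B\<^esub> \<^bold>+ f = f"
proof -
  have obj: "A \<in> Obj X" "B \<in> Obj X" using assms by auto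
  interpret H: abelian_group "Hom X A B" by (rule Hom_abelian_group) (use obj in auto)
  show "f \<^bold>+ \<zero>\<^bsub>Hom X A B\<^esub> = f" using H.r_zero[of f] assms obj by simp
  show "\<zero>\<^bsub>Hom X A B\<^esub> \<^bold>+ f = f" using H.l_zero[of f] assms obj by simp
qed

lemma add_arr_cancel [simp]:
  assumes "arr f" "arr g" "src g = src f" "tgt g = tgt f"
  shows "f \<^bold>+ (\<^bold>- f \<^bold>+ g) = g" "\<^bold>- f \<^bold>+ (f \<^bold>+ g) = g"
  using add_arr_assoc[of f "\<^bold>- f" g] add_arr_assoc[of "\<^bold>- f" f g] assms by auto

lemma add_arr_left_cancel:
  assumes "arr f" "arr g" "arr h" "src g = src f" "tgt g = tgt f" "src h = src f" "tgt h = tgt f"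
  shows "f \<^bold>+ g = f \<^bold>+ h \<longleftrightarrow> g = h"
  using add_arr_cancel(2)[of f g] add_arr_cancel(2)[of f h] assms by metis

lemma neg_arr_unique:
  assumes "arr f" "arr g" "src g = src f" "tgt g = tgt f"
    and "f \<^bold>+ g = \<zero>\<^bsub>Hom X (src f) (tgt f)\<^esub>"
  shows "g = \<^bold>- f"
  using add_arr_cancel(2)[of f g] assms by simp

lemma neg_zero_arr [simp]:
  assumes "A \<in> Obj X" "B \<in> Obj X"
  shows "\<^bold>- \<zero>\<^bsub>Hom X A B\<^esub> = \<zero>\<^bsub>Hom X A B\<^esub>"
  using neg_arr_unique[of "\<zero>\<^bsub>Hom X A B\<^esub>" "\<zero>\<^bsub>Hom X A B\<^esub>"] assms by simp

lemma cmp_zero [simp]: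
  "\<lbrakk>arr f; tgt f = B; C \<in> Obj X\<rbrakk> \<Longrightarrow> \<zero>\<^bsub>Hom X B C\<^esub> \<cdot> f = \<zero>\<^bsub>Hom X (src f) C\<^esub>"
  "\<lbrakk>arr g; src g = B; A \<in> Obj X\<rbrakk> \<Longrightarrow> g \<cdot> \<zero>\<^bsub>Hom X A B\<^esub> = \<zero>\<^bsub>Hom X A (tgt g)\<^esub>"
proof -
  assume a: "arr f" "tgt f = B" "C \<in> Obj X"
  let ?z = "\<zero>\<^bsub>Hom X B C\<^esub>"
  have B: "B \<in> Obj X" using a by auto
  have "?z \<cdot> f \<^bold>+ ?z \<cdot> f = (?z \<^bold>+ ?z) \<cdot> f" using a B by (subst cmp_add) auto
  then have "?z \<cdot> f \<^bold>+ ?z \<cdot> f = ?z \<cdot> f \<^bold>+ \<zero>\<^bsub>Hom X (src f) C\<^esub>" using a B by simp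
  then show "?z \<cdot> f = \<zero>\<^bsub>Hom X (src f) C\<^esub>" using a B by (subst (asm) add_arr_left_cancel) auto
next
  assume a: "arr g" "src g = B" "A \<in> Obj X"
  let ?z = "\<zero>\<^bsub>Hom X A B\<^esub>"
  have B: "B \<in> Obj X" using a by auto
  have "g \<cdot> ?z \<^bold>+ g \<cdot> ?z = g \<cdot> (?z \<^bold>+ ?z)" using a B by (subst cmp_add) auto
  then have "g \<cdot> ?z \<^bold>+ g \<cdot> ?z = g \<cdot> ?z \<^bold>+ \<zero>\<^bsub>Hom X A (tgt g)\<^esub>" using a B by simp
  then show "g \<cdot> ?z = \<zero>\<^bsub>Hom X A (tgt g)\<^esub>" using a B by (subst (asm) add_arr_left_cancel) auto
qed

lemma cmp_neg [simp]:
  "\<lbrakk>arr f; arr g; tgt f = src g\<rbrakk> \<Longrightarrow> (\<^bold>- g) \<cdot> f = \<^bold>- (g \<cdot> f)"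
  "\<lbrakk>arr f; arr g; tgt f = src g\<rbrakk> \<Longrightarrow> g \<cdot> (\<^bold>- f) = \<^bold>- (g \<cdot> f)"
proof -
  assume a: "arr f" "arr g" "tgt f = src g"
  have "g \<cdot> f \<^bold>+ (\<^bold>- g) \<cdot> f = (g \<^bold>+ \<^bold>- g) \<cdot> f" using a by (subst cmp_add) auto
  then have "g \<cdot> f \<^bold>+ (\<^bold>- g) \<cdot> f = \<zero>\<^bsub>Hom X (src f) (tgt g)\<^esub>" using a by simp
  then show "(\<^bold>- g) \<cdot> f = \<^bold>- (g \<cdot> f)" using neg_arr_unique[of "g \<cdot> f" "(\<^bold>- g) \<cdot> f"] a by simp
  have "g \<cdot> f \<^bold>+ g \<cdot> (\<^bold>- f) = g \<cdot> (f \<^bold>+ \<^bold>- f)" using a by (subst cmp_add) auto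
  then have "g \<cdot> f \<^bold>+ g \<cdot> (\<^bold>- f) = \<zero>\<^bsub>Hom X (src f) (tgt g)\<^esub>" using a by simp
  then show "g \<cdot> (\<^bold>- f) = \<^bold>- (g \<cdot> f)" using neg_arr_unique[of "g \<cdot> f" "g \<cdot> (\<^bold>- f)"] a by simp
qed

lemma neg_add_arr:
  assumes "arr f" "arr g" "src g = src f" "tgt g = tgt f"
  shows "\<^bold>- (f \<^bold>+ g) = \<^bold>- f \<^bold>+ \<^bold>- g"
proof -
  interpret H: abelian_group "Hom X (src f) (tgt f)" by (rule Hom_abelian_group) (use assms in auto)
  show ?thesis using H.minus_add[of f g] assms by simp
qed

section \<open>Direct sums\<close>

lemma prj_inj [simp]:
  assumes "A \<in> Obj X" "B \<in> Obj X"
  shows "prj1 X A B \<cdot> inj1 X A B = ident X A" "prj2 X A B \<cdot> inj2 X A B = ident X B"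
    "prj1 X A B \<cdot> inj2 X A B = \<zero>\<^bsub>Hom X B A\<^esub>" "prj2 X A B \<cdot> inj1 X A B = \<zero>\<^bsub>Hom X A B\<^esub>"
  using assms prj1_inj1 prj2_inj2 prj1_inj2 prj2_inj1 by auto

lemma prj_inj_cmp [simp]:
  assumes "A \<in> Obj X" "B \<in> Obj X" "arr w"
  shows "tgt w = A \<Longrightarrow> prj1 X A B \<cdot> (inj1 X A B \<cdot> w) = w"
    "tgt w = B \<Longrightarrow> prj2 X A B \<cdot> (inj2 X A B \<cdot> w) = w"
    "tgt w = B \<Longrightarrow> prj1 X A B \<cdot> (inj2 X A B \<cdot> w) = \<zero>\<^bsub>Hom X (src w) A\<^esub>"
    "tgt w = A \<Longrightarrow> prj2 X A B \<cdot> (inj1 X A B \<cdot> w) = \<zero>\<^bsub>Hom X (src w) B\<^esub>"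
  using assms by (simp_all flip: cmp_cmp)

lemma arr_into_dsum:
  assumes "arr w" "tgt w = A \<boxplus> B" "A \<in> Obj X" "B \<in> Obj X"
  shows "w = inj1 X A B \<cdot> (prj1 X A B \<cdot> w) \<^bold>+ inj2 X A B \<cdot> (prj2 X A B \<cdot> w)"
proof -
  have "w = (inj1 X A B \<cdot> prj1 X A B \<^bold>+ inj2 X A B \<cdot> prj2 X A B) \<cdot> w"
    using inj_prj_sum[of A B] assms by simp
  then show ?thesis using assms by simp
qed

lemma arr_out_of_dsum:
  assumes "arr w" "src w = A \<boxplus> B" "A \<in> Obj X" "B \<in> Obj X"
  shows "w = w \<cdot> (inj1 X A B \<cdot> prj1 X A B) \<^bold>+ w \<cdot> (inj2 X A B \<cdot> prj2 X A B)"
proof -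
  have "w = w \<cdot> (inj1 X A B \<cdot> prj1 X A B \<^bold>+ inj2 X A B \<cdot> prj2 X A B)"
    using inj_prj_sum[of A B] assms by simp
  then show ?thesis using assms by simp
qed

lemma arr_into_dsum_eqI:
  assumes "arr v" "tgt v = A \<boxplus> B" "arr w" "tgt w = A \<boxplus> B" "A \<in> Obj X" "B \<in> Obj X"
    and "prj1 X A B \<cdot> v = prj1 X A B \<cdot> w" "prj2 X A B \<cdot> v = prj2 X A B \<cdot> w"
  shows "v = w"
  using arr_into_dsum[of v A B] arr_into_dsum[of w A B] assms by simp

lemma arr_out_of_dsum_eqI:
  assumes "arr v" "src v = A \<boxplus> B" "arr w" "src w = A \<boxplus> B" "A \<in> Obj X" "B \<in> Obj X"
    and "v \<cdot> inj1 X A B = w \<cdot> inj1 X A B" "v \<cdot> inj2 X A B = w \<cdot> inj2 X A B"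
  shows "v = w"
proof -
  have "v \<cdot> (inj1 X A B \<cdot> prj1 X A B) = w \<cdot> (inj1 X A B \<cdot> prj1 X A B)"
    "v \<cdot> (inj2 X A B \<cdot> prj2 X A B) = w \<cdot> (inj2 X A B \<cdot> prj2 X A B)"
    using assms by (simp_all flip: cmp_cmp)
  then show ?thesis using arr_out_of_dsum[of v A B] arr_out_of_dsum[of w A B] assms by simp
qed

lemma col_arr [simp]:
  assumes "A \<in> Obj X" "B \<in> Obj X" "arr u" "arr v"
    "src u = W" "src v = W" "tgt u = A" "tgt v = B"
  shows "arr (col X W A B u v)" "src (col X W A B u v) = W" "tgt (col X W A B u v) = A \<boxplus> B"
    "prj1 X A B \<cdot> col X W A B u v = u" "prj2 X A B \<cdot> col X W A B u v = v"
  unfolding col_def using assms by auto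

lemma row_arr [simp]:
  assumes "A \<in> Obj X" "B \<in> Obj X" "arr u" "arr v"
    "src u = A" "src v = B" "tgt u = W" "tgt v = W"
  shows "arr (row X A B W u v)" "src (row X A B W u v) = A \<boxplus> B" "tgt (row X A B W u v) = W"
    "row X A B W u v \<cdot> inj1 X A B = u" "row X A B W u v \<cdot> inj2 X A B = v"
  unfolding row_def using assms by auto

lemma col_cmp [simp]:
  assumes "arr u" "arr v" "src u = W" "src v = W" "tgt u = A" "tgt v = B" "arr w" "tgt w = W"
  shows "prj1 X A B \<cdot> (col X W A B u v \<cdot> w) = u \<cdot> w" "prj2 X A B \<cdot> (col X W A B u v \<cdot> w) = v \<cdot> w"
  using assms by (auto simp flip: cmp_cmp)

lemma row_cmp [simp]:
  assumes "arr u" "arr v" "src u = A" "src v = B" "tgt u = W" "tgt v = W" "arr w"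
  shows "tgt w = A \<Longrightarrow> row X A B W u v \<cdot> (inj1 X A B \<cdot> w) = u \<cdot> w"
    "tgt w = B \<Longrightarrow> row X A B W u v \<cdot> (inj2 X A B \<cdot> w) = v \<cdot> w"
  using assms by (auto simp flip: cmp_cmp)

lemma row_col [simp]:
  assumes "arr u" "arr v" "src u = A" "src v = B" "tgt u = W" "tgt v = W"
    "arr u'" "arr v'" "src u' = W'" "src v' = W'" "tgt u' = A" "tgt v' = B"
  shows "row X A B W u v \<cdot> col X W' A B u' v' = u \<cdot> u' \<^bold>+ v \<cdot> v'"
  unfolding col_def using assms by auto

section \<open>Isomorphisms\<close>

lemma is_iso_iff:
  assumes "B \<in> Obj X" "B' \<in> Obj X"
  shows "is_iso X b B B' \<longleftrightarrow> arr b \<and> src b = B \<and> tgt b = B' \<and>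
    (\<exists>b'. arr b' \<and> src b' = B' \<and> tgt b' = B \<and> b' \<cdot> b = ident X B \<and> b \<cdot> b' = ident X B')"
  using assms unfolding is_iso_def by auto

text \<open>With \<open>n = u - 1\<close> the inverse is \<open>1 - n\<close>.\<close>

lemma unipotent_iso:
  assumes u: "arr u" "src u = B" "tgt u = B"
    and sq: "(u \<^bold>+ \<^bold>- ident X B) \<cdot> (u \<^bold>+ \<^bold>- ident X B) = \<zero>\<^bsub>Hom X B B\<^esub>"
  shows "is_iso X u B B"
proof -
  have B: "B \<in> Obj X" using u by auto
  define n where "n = u \<^bold>+ \<^bold>- ident X B"
  have n: "arr n" "src n = B" "tgt n = B" "n \<cdot> n = \<zero>\<^bsub>Hom X B B\<^esub>"
    using u B sq unfolding n_def by auto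
  have un: "u = ident X B \<^bold>+ n"
    using u B add_arr_commute[of "ident X B" n] unfolding n_def by (simp add: add_arr_assoc)
  have "(ident X B \<^bold>+ \<^bold>- n) \<cdot> u = ident X B" "u \<cdot> (ident X B \<^bold>+ \<^bold>- n) = ident X B"
    unfolding un using n B
    by (simp_all add: add_arr_assoc add_arr_commute[of n])
  then show ?thesis using u B n unfolding is_iso_iff[OF B B]
    by (intro conjI exI[of _ "ident X B \<^bold>+ \<^bold>- n"]) auto
qed

text \<open>If \<open>p\<close> inverts \<open>v \<cdot> u\<close> and \<open>q\<close> inverts \<open>u \<cdot> v\<close>, then \<open>p \<cdot> v\<close> is a left and \<open>v \<cdot> q\<close> a right
  inverse of \<open>u\<close>, so they agree.\<close>

lemma iso_of_iso_composites:
  assumes "arr u" "src u = B" "tgt u = B'" "arr v" "src v = B'" "tgt v = B"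
    and "is_iso X (v \<cdot> u) B B" "is_iso X (u \<cdot> v) B' B'"
  shows "is_iso X u B B'"
proof -
  have obj: "B \<in> Obj X" "B' \<in> Obj X" using assms by auto
  obtain p where p: "arr p" "src p = B" "tgt p = B" "p \<cdot> (v \<cdot> u) = ident X B"
    using assms(7) obj unfolding is_iso_iff[OF obj(1) obj(1)] by auto
  obtain q where q: "arr q" "src q = B'" "tgt q = B'" "u \<cdot> (v \<cdot> q) = ident X B'"
    using assms obj unfolding is_iso_iff[OF obj(2) obj(2)] by auto
  have "p \<cdot> v = p \<cdot> (v \<cdot> (u \<cdot> (v \<cdot> q)))" using assms p q obj by simp
  also have "\<dots> = (p \<cdot> (v \<cdot> u)) \<cdot> (v \<cdot> q)" using assms p(1-3) q(1-3) obj by simp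
  also have "\<dots> = v \<cdot> q" unfolding p(4) using assms p q by simp
  finally have "(v \<cdot> q) \<cdot> u = ident X B" using assms p q by (metis cmp_cmp)
  then show ?thesis unfolding is_iso_iff[OF obj] using assms q
    by (intro conjI exI[of _ "v \<cdot> q"]) auto
qed

end


section \<open>Extensions\<close>

context biadditive_functor
begin

lemma zero_Ext [simp]:
  assumes "C \<in> Obj X" "A \<in> Obj X"
  shows "\<zero>\<^bsub>Ext X C A\<^esub> \<in> carrier (Ext X C A)"
  using abelian_monoid.zero_closed[OF abelian_group.axioms(1)[OF Ext_abelian_group[OF assms]]] .

lemma add_Ext [simp]:
  assumes "C \<in> Obj X" "A \<in> Obj X" "\<delta> \<in> carrier (Ext X C A)" "\<epsilon> \<in> carrier (Ext X C A)"
  shows "\<delta> \<oplus>\<^bsub>Ext X C A\<^esub> \<epsilon> \<in> carrier (Ext X C A)"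
proof -
  interpret abelian_group "Ext X C A" by (rule Ext_abelian_group) (use assms in auto)
  show ?thesis using assms by simp
qed

lemma add_zero_Ext [simp]:
  assumes "C \<in> Obj X" "A \<in> Obj X" "\<delta> \<in> carrier (Ext X C A)"
  shows "\<delta> \<oplus>\<^bsub>Ext X C A\<^esub> \<zero>\<^bsub>Ext X C A\<^esub> = \<delta>" "\<zero>\<^bsub>Ext X C A\<^esub> \<oplus>\<^bsub>Ext X C A\<^esub> \<delta> = \<delta>"
proof -
  interpret abelian_group "Ext X C A" by (rule Ext_abelian_group) (use assms in auto)
  show "\<delta> \<oplus>\<^bsub>Ext X C A\<^esub> \<zero>\<^bsub>Ext X C A\<^esub> = \<delta>" "\<zero>\<^bsub>Ext X C A\<^esub> \<oplus>\<^bsub>Ext X C A\<^esub> \<delta> = \<delta>"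
    using assms by simp_all
qed

lemma add_Ext_left_cancel:
  assumes "C \<in> Obj X" "A \<in> Obj X" "\<delta> \<in> carrier (Ext X C A)" "\<epsilon> \<in> carrier (Ext X C A)"
    "\<eta> \<in> carrier (Ext X C A)" "\<delta> \<oplus>\<^bsub>Ext X C A\<^esub> \<epsilon> = \<delta> \<oplus>\<^bsub>Ext X C A\<^esub> \<eta>"
  shows "\<epsilon> = \<eta>"
proof -
  interpret abelian_group "Ext X C A" by (rule Ext_abelian_group) (use assms in auto)
  show ?thesis using r_neg1[OF assms(3,4)] r_neg1[OF assms(3,5)] assms(6) by metis
qed

lemma Emap_Ext [simp]:
  "\<lbrakk>arr c; arr a; src c = C; tgt a = A; \<delta> \<in> carrier (Ext X (tgt c) (src a))\<rbrakk>
   \<Longrightarrow> Emap X c a \<delta> \<in> carrier (Ext X C A)"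
  by (rule Emap_closed[of "tgt c" C "src a" A]) auto

lemma Emap_Emap [simp]:
  "\<lbrakk>arr c; arr a; arr c'; arr a'; tgt c' = src c; src a' = tgt a;
    \<delta> \<in> carrier (Ext X (tgt c) (src a))\<rbrakk>
   \<Longrightarrow> Emap X c' a' (Emap X c a \<delta>) = Emap X (c \<cdot> c') (a' \<cdot> a) \<delta>"
  using Emap_cmp[of "tgt c" "src c" "src c'" "src a" "tgt a" "tgt a'" c c' a a' \<delta>] by simp

declare Emap_ident [simp]

lemma Emap_add_Ext [simp]:
  "\<lbrakk>arr c; arr a; tgt c = C; src a = A; C \<in> Obj X; A \<in> Obj X;
    \<delta> \<in> carrier (Ext X C A); \<epsilon> \<in> carrier (Ext X C A)\<rbrakk>
   \<Longrightarrow> Emap X c a (\<delta> \<oplus>\<^bsub>Ext X C A\<^esub> \<epsilon>) = Emap X c a \<delta> \<oplus>\<^bsub>Ext X (src c) (tgt a)\<^esub> Emap X c a \<epsilon>"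
  by (rule Emap_add) auto

lemma Emap_add_arr [simp]:
  "\<lbrakk>arr c; arr c'; src c' = src c; tgt c' = tgt c; arr a; \<delta> \<in> carrier (Ext X (tgt c) (src a))\<rbrakk>
   \<Longrightarrow> Emap X (c \<^bold>+ c') a \<delta> = Emap X c a \<delta> \<oplus>\<^bsub>Ext X (src c) (tgt a)\<^esub> Emap X c' a \<delta>"
  "\<lbrakk>arr c; arr a; arr a'; src a' = src a; tgt a' = tgt a; \<delta> \<in> carrier (Ext X (tgt c) (src a))\<rbrakk>
   \<Longrightarrow> Emap X c (a \<^bold>+ a') \<delta> = Emap X c a \<delta> \<oplus>\<^bsub>Ext X (src c) (tgt a)\<^esub> Emap X c a' \<delta>"
  using Emap_add_left[of "tgt c" "src c" "src a" "tgt a" c c' a \<delta>]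
    Emap_add_right[of "tgt c" "src c" "src a" "tgt a" c a a' \<delta>] by auto

lemma Emap_zero_arr [simp]:
  "\<lbrakk>C \<in> Obj X; C' \<in> Obj X; arr a; \<delta> \<in> carrier (Ext X C (src a))\<rbrakk>
   \<Longrightarrow> Emap X \<zero>\<^bsub>Hom X C' C\<^esub> a \<delta> = \<zero>\<^bsub>Ext X C' (tgt a)\<^esub>"
  "\<lbrakk>A \<in> Obj X; A' \<in> Obj X; arr c; \<delta> \<in> carrier (Ext X (tgt c) A)\<rbrakk>
   \<Longrightarrow> Emap X c \<zero>\<^bsub>Hom X A A'\<^esub> \<delta> = \<zero>\<^bsub>Ext X (src c) A'\<^esub>"
  using Emap_zero_left[of C C' "src a" "tgt a" a \<delta>] Emap_zero_right[of "tgt c" "src c" A A' c \<delta>]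
  by auto

lemma Emap_zero_Ext [simp]:
  assumes "arr c" "arr a" "tgt c = C" "src a = A" "C \<in> Obj X" "A \<in> Obj X"
  shows "Emap X c a \<zero>\<^bsub>Ext X C A\<^esub> = \<zero>\<^bsub>Ext X (src c) (tgt a)\<^esub>"
proof -
  have "Emap X c a \<zero>\<^bsub>Ext X C A\<^esub> = Emap X c a (Emap X \<zero>\<^bsub>Hom X C C\<^esub> (ident X A) \<zero>\<^bsub>Ext X C A\<^esub>)"
    using assms by (subst Emap_zero_arr) auto
  also have "\<dots> = \<zero>\<^bsub>Ext X (src c) (tgt a)\<^esub>" using assms by (subst Emap_Emap) auto
  finally show ?thesis .
qed

lemma E_triangleD:
  assumes "E_triangle X A x B y C \<delta>"
  shows "A \<in> Obj X" "B \<in> Obj X" "C \<in> Obj X" "arr x" "src x = A" "tgt x = B"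
    "arr y" "src y = B" "tgt y = C" "\<delta> \<in> carrier (Ext X C A)"
  using assms unfolding E_triangle_def by auto

lemma seq_class_eq_iff:
  assumes "A \<in> Obj X" "B \<in> Obj X" "C \<in> Obj X" "arr x" "src x = A" "tgt x = B"
    "arr y" "src y = B" "tgt y = C"
    "B' \<in> Obj X" "arr x'" "src x' = A" "tgt x' = B'" "arr y'" "src y' = B'" "tgt y' = C"
  shows "seq_class X A x B y C = seq_class X A x' B' y' C \<longleftrightarrow>
    (\<exists>b. is_iso X b B B' \<and> b \<cdot> x = x' \<and> y' \<cdot> b = y)"
  unfolding seq_class_def
  by (subst eq_equiv_class_iff[OF equiv_seq_equiv[of A C]])
    (use assms in \<open>auto simp: seqs_def seq_equiv_def\<close>)

lemma E_triangle_unique_middle: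
  assumes t: "E_triangle X A x B y C \<delta>" and t': "E_triangle X A x' B' y' C \<delta>"
  shows "\<exists>b. is_iso X b B B' \<and> b \<cdot> x = x' \<and> y' \<cdot> b = y"
  using seq_class_eq_iff[of A B C x y B' x' y'] E_triangleD[OF t] E_triangleD[OF t'] t t'
  unfolding E_triangle_def by simp

lemma E_triangle_iso_middle:
  assumes t: "E_triangle X A x B y C \<delta>" and b: "is_iso X b B B'" and B': "B' \<in> Obj X"
    and x': "b \<cdot> x = x'" and y': "arr y'" "src y' = B'" "tgt y' = C" "y' \<cdot> b = y"
  shows "E_triangle X A x' B' y' C \<delta>"
proof -
  note d = E_triangleD[OF t]
  have b': "arr b" "src b = B" "tgt b = B'" using b d B' by (auto simp: is_iso_iff)
  have x'': "arr x'" "src x' = A" "tgt x' = B'" using x' b' d by auto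
  show ?thesis
    using seq_class_eq_iff[of A B C x y B' x' y'] d B' x' x'' y' b t unfolding E_triangle_def
    by auto
qed

end


section \<open>Exactness and uniqueness in pre-extriangulated categories\<close>

context pre_extriangulated
begin

lemma push_Emap [simp]: "push X C a \<delta> = Emap X (ident X C) a \<delta>"
  and pull_Emap [simp]: "pull X A c \<delta> = Emap X c (ident X A) \<delta>"
  by (simp_all add: push_def pull_def)

lemma split_triangle:
  assumes "A \<in> Obj X" "C \<in> Obj X"
  shows "E_triangle X A (inj1 X A C) (A \<boxplus> C) (prj2 X A C) C \<zero>\<^bsub>Ext X C A\<^esub>"
proof -
  have "col X A A C (ident X A) \<zero>\<^bsub>Hom X A C\<^esub> = inj1 X A C"
    "row X A C C \<zero>\<^bsub>Hom X A C\<^esub> (ident X C) = prj2 X A C"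
    using assms by (simp_all add: col_def row_def)
  then show ?thesis using realize_zero[of C A] assms unfolding E_triangle_def by simp
qed

lemma E_triangle_exists:
  assumes "A \<in> Obj X" "C \<in> Obj X" "\<delta> \<in> carrier (Ext X C A)"
  obtains x B y where "E_triangle X A x B y C \<delta>"
proof -
  from realize_class[of C A \<delta>] assms
  obtain s where s: "s \<in> seqs X A C" "realize X C A \<delta> = seq_equiv X A C `` {s}"
    by (auto elim: quotientE)
  obtain B x y where "s = (B, x, y)" by (cases s)
  then have "E_triangle X A x B y C \<delta>"
    using s assms by (auto simp: E_triangle_def seqs_def seq_class_def)
  then show thesis by (rule that)
qed

lemma realize_morphismE:
  assumes t: "E_triangle X A x B y C \<delta>" and t': "E_triangle X A' x' B' y' C' \<delta>'"
    and "arr a" "src a = A" "tgt a = A'" "arr c" "src c = C" "tgt c = C'"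
    and "Emap X (ident X C) a \<delta> = Emap X c (ident X A') \<delta>'"
  obtains b where "arr b" "src b = B" "tgt b = B'" "b \<cdot> x = x' \<cdot> a" "y' \<cdot> b = c \<cdot> y"
  using realize_morphism[OF t t', of a c] E_triangleD[OF t] E_triangleD[OF t'] assms
  by (auto simp: ext_morphism_def)

lemma ET3E:
  assumes t: "E_triangle X A x B y C \<delta>" and t': "E_triangle X A' x' B' y' C' \<delta>'"
    and "arr a" "src a = A" "tgt a = A'" "arr b" "src b = B" "tgt b = B'" "b \<cdot> x = x' \<cdot> a"
  obtains c where "arr c" "src c = C" "tgt c = C'" "y' \<cdot> b = c \<cdot> y"
    "Emap X (ident X C) a \<delta> = Emap X c (ident X A') \<delta>'"
  using ET3[OF t t', of a b] E_triangleD[OF t] E_triangleD[OF t'] assms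
  by (auto simp: E_triangle_morphism_def)

lemma ET3_opE:
  assumes t: "E_triangle X A x B y C \<delta>" and t': "E_triangle X A' x' B' y' C' \<delta>'"
    and "arr b" "src b = B" "tgt b = B'" "arr c" "src c = C" "tgt c = C'" "y' \<cdot> b = c \<cdot> y"
  obtains a where "arr a" "src a = A" "tgt a = A'" "b \<cdot> x = x' \<cdot> a"
    "Emap X (ident X C) a \<delta> = Emap X c (ident X A') \<delta>'"
  using ET3_op[OF t t', of b c] E_triangleD[OF t] E_triangleD[OF t'] assms
  by (auto simp: E_triangle_morphism_def)

text \<open>The exactness statements that follow all come from comparing the given triangle with a split
  triangle of the zero extension: each asks for one morphism of triangles, which (ET3), its dual,
  or the realization of a morphism of extensions provides.\<close>

lemma E_triangle_cmp_zero:
  assumes t: "E_triangle X A x B y C \<delta>"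
  shows "y \<cdot> x = \<zero>\<^bsub>Hom X A C\<^esub>"
proof -
  note d = E_triangleD[OF t]
  obtain c where c: "arr c" "src c = C" "tgt c = C" "y \<cdot> (x \<cdot> prj1 X A C) = c \<cdot> prj2 X A C"
    by (rule ET3E[OF split_triangle[of A C] t, of "ident X A" "x \<cdot> prj1 X A C"]) (use d in auto)
  have "y \<cdot> x = (y \<cdot> (x \<cdot> prj1 X A C)) \<cdot> inj1 X A C" using d by simp
  also have "\<dots> = \<zero>\<^bsub>Hom X A C\<^esub>" unfolding c(4) using c(1-3) d by simp
  finally show ?thesis .
qed

lemma E_triangle_push_zero:
  assumes t: "E_triangle X A x B y C \<delta>"
  shows "Emap X (ident X C) x \<delta> = \<zero>\<^bsub>Ext X C B\<^esub>"
proof -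
  note d = E_triangleD[OF t]
  obtain c where "arr c" "src c = C" "tgt c = C"
    "Emap X (ident X C) x \<delta> = Emap X c (ident X B) \<zero>\<^bsub>Ext X C B\<^esub>"
    by (rule ET3E[OF t split_triangle[of B C], of x "inj1 X B C"]) (use d in auto)
  then show ?thesis using d by simp
qed

lemma E_triangle_pull_zero:
  assumes t: "E_triangle X A x B y C \<delta>"
  shows "Emap X y (ident X A) \<delta> = \<zero>\<^bsub>Ext X B A\<^esub>"
proof -
  note d = E_triangleD[OF t]
  obtain a where "arr a" "src a = A" "tgt a = A"
    "Emap X (ident X B) a \<zero>\<^bsub>Ext X B A\<^esub> = Emap X y (ident X A) \<delta>"
    by (rule ET3_opE[OF split_triangle[of A B] t, of "prj2 X A B" y]) (use d in auto)
  then show ?thesis using d by simp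
qed

lemma factor_through_inflation:
  assumes t: "E_triangle X A x B y C \<delta>" and u: "arr u" "tgt u = B"
    and yu: "y \<cdot> u = \<zero>\<^bsub>Hom X (src u) C\<^esub>"
  obtains t where "arr t" "src t = src u" "tgt t = A" "u = x \<cdot> t"
proof -
  note d = E_triangleD[OF t]
  let ?W = "src u"
  have W: "?W \<in> Obj X" using u by simp
  have e: "y \<cdot> (u \<cdot> prj1 X ?W C) = \<zero>\<^bsub>Hom X C C\<^esub> \<cdot> prj2 X ?W C"
    using d u W by (simp add: cmp_prolong[OF yu])
  have p: "arr (u \<cdot> prj1 X ?W C)" "src (u \<cdot> prj1 X ?W C) = ?W \<boxplus> C" "tgt (u \<cdot> prj1 X ?W C) = B"
    using d u W by simp_all
  obtain a where a: "arr a" "src a = ?W" "tgt a = A" "(u \<cdot> prj1 X ?W C) \<cdot> inj1 X ?W C = x \<cdot> a"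
    by (rule ET3_opE[OF split_triangle[OF W d(3)] t p zero_arr[OF d(3) d(3)] e])
  have "u = x \<cdot> a" using a(4) u W d by simp
  then show thesis using that a by blast
qed

lemma factor_through_deflation:
  assumes t: "E_triangle X A x B y C \<delta>" and c: "arr c" "tgt c = C"
    and pull: "Emap X c (ident X A) \<delta> = \<zero>\<^bsub>Ext X (src c) A\<^esub>"
  obtains s where "arr s" "src s = src c" "tgt s = B" "c = y \<cdot> s"
proof -
  note d = E_triangleD[OF t]
  let ?W = "src c"
  have W: "?W \<in> Obj X" using c by simp
  obtain b where b: "arr b" "src b = A \<boxplus> ?W" "tgt b = B" "y \<cdot> b = c \<cdot> prj2 X A ?W"
    by (rule realize_morphismE[OF split_triangle[of A ?W] t, of "ident X A" c])
      (use d c W pull in auto)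
  have "y \<cdot> (b \<cdot> inj2 X A ?W) = c" using b c d W by (subst cmp_prolong[OF b(4)]) auto
  then show thesis using that[of "b \<cdot> inj2 X A ?W"] b W d by simp
qed

lemma extend_along_inflation:
  assumes t: "E_triangle X A x B y C \<delta>" and a: "arr a" "src a = A"
    and push: "Emap X (ident X C) a \<delta> = \<zero>\<^bsub>Ext X C (tgt a)\<^esub>"
  obtains k where "arr k" "src k = B" "tgt k = tgt a" "a = k \<cdot> x"
proof -
  note d = E_triangleD[OF t]
  let ?W = "tgt a"
  have W: "?W \<in> Obj X" using a by simp
  obtain b where b: "arr b" "src b = B" "tgt b = ?W \<boxplus> C" "b \<cdot> x = inj1 X ?W C \<cdot> a"
    by (rule realize_morphismE[OF t split_triangle[of ?W C], of a "ident X C"])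
      (use d a W push in auto)
  then show thesis using that[of "prj1 X ?W C \<cdot> b"] a d W by simp
qed

text \<open>An endomorphism of a sequence that fixes both ends is \<open>1 + n\<close> with \<open>n\<close> factoring through
  \<open>x\<close> and vanishing on it, so that \<open>n\<^sup>2 = 0\<close>.\<close>

lemma sequence_endomorphism_iso:
  assumes x: "arr x" "src x = A" "tgt x = B" and y: "arr y" "src y = B" "tgt y = C"
    and u: "arr u" "src u = B" "tgt u = B" "u \<cdot> x = x" "y \<cdot> u = y"
    and exact: "\<And>w. \<lbrakk>arr w; src w = B; tgt w = B; y \<cdot> w = \<zero>\<^bsub>Hom X B C\<^esub>\<rbrakk>
      \<Longrightarrow> \<exists>t. arr t \<and> src t = B \<and> tgt t = A \<and> w = x \<cdot> t"
  shows "is_iso X u B B"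
proof (rule unipotent_iso[OF u(1-3)])
  have obj: "A \<in> Obj X" "B \<in> Obj X" "C \<in> Obj X" using x y by auto
  let ?n = "u \<^bold>+ \<^bold>- ident X B"
  have n: "arr ?n" "src ?n = B" "tgt ?n = B" using u obj by auto
  have "y \<cdot> ?n = \<zero>\<^bsub>Hom X B C\<^esub>" using u y obj by simp
  then obtain t where t: "arr t" "src t = B" "tgt t = A" "?n = x \<cdot> t" using exact[OF n] by auto
  have "?n \<cdot> x = \<zero>\<^bsub>Hom X A B\<^esub>" using u x obj by simp
  then have "?n \<cdot> (x \<cdot> t) = \<zero>\<^bsub>Hom X A B\<^esub> \<cdot> t"
    by (rule cmp_prolong) (use n x t in auto)
  then show "?n \<cdot> ?n = \<zero>\<^bsub>Hom X B B\<^esub>" using t obj by (metis cmp_zero(1))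
qed

text \<open>Both composites of \<open>p\<close> and \<open>q\<close> fix the ends of their sequence, so they are isomorphisms by the
  previous lemma, and with them \<open>p\<close>.\<close>

lemma E_triangle_by_comparison:
  assumes t: "E_triangle X A x B y C \<delta>"
    and x': "arr x'" "src x' = A" "tgt x' = B'" and y': "arr y'" "src y' = B'" "tgt y' = C"
    and p: "arr p" "src p = B" "tgt p = B'" "p \<cdot> x = x'" "y' \<cdot> p = y"
    and q: "arr q" "src q = B'" "tgt q = B" "q \<cdot> x' = x" "y \<cdot> q = y'"
    and exact: "\<And>w. \<lbrakk>arr w; src w = B'; tgt w = B'; y' \<cdot> w = \<zero>\<^bsub>Hom X B' C\<^esub>\<rbrakk>
      \<Longrightarrow> \<exists>t. arr t \<and> src t = B' \<and> tgt t = A \<and> w = x' \<cdot> t"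
  shows "E_triangle X A x' B' y' C \<delta>"
proof (rule E_triangle_iso_middle[OF t])
  note d = E_triangleD[OF t]
  show B': "B' \<in> Obj X" using x' by auto
  have "is_iso X (q \<cdot> p) B B"
  proof (rule sequence_endomorphism_iso[OF d(4-9)])
    show "y \<cdot> (q \<cdot> p) = y" using cmp_prolong[OF q(5)] p q d by simp
    show "\<exists>t. arr t \<and> src t = B \<and> tgt t = A \<and> w = x \<cdot> t"
      if w: "arr w" "src w = B" "tgt w = B" "y \<cdot> w = \<zero>\<^bsub>Hom X B C\<^esub>" for w
      by (rule factor_through_inflation[OF t w(1,3)]) (use w in auto)
  qed (use d p q in simp_all)
  moreover have "is_iso X (p \<cdot> q) B' B'"
  proof (rule sequence_endomorphism_iso[OF x' y'])
    show "y' \<cdot> (p \<cdot> q) = y'" using cmp_prolong[OF p(5)] p q d y' by simp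
  qed (use p q x' exact in simp_all)
  ultimately show "is_iso X p B B'" by (rule iso_of_iso_composites[OF p(1-3) q(1-3)])
qed (use p y' in auto)

text \<open>The candidate sequence is compared with some realization of the transported extension; the
  morphisms of extensions \<open>(1, c)\<close> and \<open>(1, c')\<close> give the comparison in both directions.\<close>

lemma E_triangle_iso_third:
  assumes t: "E_triangle X A x B y C \<delta>"
    and c: "arr c" "src c = C" "tgt c = C'" and c': "arr c'" "src c' = C'" "tgt c' = C"
    and inv: "c' \<cdot> c = ident X C" "c \<cdot> c' = ident X C'"
  shows "E_triangle X A x B (c \<cdot> y) C' (Emap X c' (ident X A) \<delta>)"
proof -
  note d = E_triangleD[OF t]
  have C': "C' \<in> Obj X" using c by auto
  let ?\<delta> = "Emap X c' (ident X A) \<delta>"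
  have \<delta>: "?\<delta> \<in> carrier (Ext X C' A)" using d c' by simp
  obtain z Q w where q: "E_triangle X A z Q w C' ?\<delta>"
    using E_triangle_exists[OF d(1) C' \<delta>] .
  note dq = E_triangleD[OF q]
  obtain b where b: "arr b" "src b = B" "tgt b = Q" "b \<cdot> x = z \<cdot> ident X A" "w \<cdot> b = c \<cdot> y"
    by (rule realize_morphismE[OF t q, of "ident X A" c]) (use d c c' inv in auto)
  obtain b' where b': "arr b'" "src b' = Q" "tgt b' = B" "b' \<cdot> z = x \<cdot> ident X A" "y \<cdot> b' = c' \<cdot> w"
    by (rule realize_morphismE[OF q t, of "ident X A" c']) (use d c c' inv C' in auto)
  show ?thesis
  proof (rule E_triangle_by_comparison[OF q, where p = b' and q = b])
    show "(c \<cdot> y) \<cdot> b' = w" using b' c c' d dq inv cmp_prolong[OF inv(2), of w] by simp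
    show "\<exists>t. arr t \<and> src t = B \<and> tgt t = A \<and> v = x \<cdot> t"
      if v: "arr v" "src v = B" "tgt v = B" "(c \<cdot> y) \<cdot> v = \<zero>\<^bsub>Hom X B C'\<^esub>" for v
    proof -
      have "c' \<cdot> ((c \<cdot> y) \<cdot> v) = y \<cdot> v" using v(1-3) c c' d inv cmp_prolong[OF inv(1)] by simp
      then have "y \<cdot> v = \<zero>\<^bsub>Hom X B C\<^esub>" unfolding v(4) using c' C' d by simp
      then show ?thesis by (metis factor_through_inflation[OF t v(1,3)] v(2))
    qed
  qed (use b b' c d dq in simp_all)
qed

text \<open>The endomorphism of the cone obtained by composing comparisons is again unipotent, because
  \<open>1 - u\<close> pulls \<open>\<delta>\<close> back to zero and hence factors through the deflation, on which it vanishes.\<close>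

lemma cone_unique:
  assumes t: "E_triangle X A x B y C \<delta>" and t': "E_triangle X A x B y' C' \<delta>'"
  obtains c where "is_iso X c C C'" "arr c" "src c = C" "tgt c = C'" "c \<cdot> y = y'"
    "Emap X c (ident X A) \<delta>' = \<delta>"
proof -
  have unip: "is_iso X u C C"
    if t: "E_triangle X A x B y C \<delta>" and u: "arr u" "src u = C" "tgt u = C" "u \<cdot> y = y"
      and pull: "Emap X u (ident X A) \<delta> = \<delta>" for C y u \<delta>
  proof (rule unipotent_iso[OF u(1-3)])
    note d = E_triangleD[OF t]
    define n where "n = u \<^bold>+ \<^bold>- ident X C"
    have n: "arr n" "src n = C" "tgt n = C" using u d unfolding n_def by auto
    have u_n: "u = ident X C \<^bold>+ n"
      using u d add_arr_commute[of "ident X C" n] unfolding n_def by (simp add: add_arr_assoc)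
    have "\<delta> \<oplus>\<^bsub>Ext X C A\<^esub> Emap X n (ident X A) \<delta> = \<delta> \<oplus>\<^bsub>Ext X C A\<^esub> \<zero>\<^bsub>Ext X C A\<^esub>"
      using pull d n unfolding u_n by simp
    then have "Emap X n (ident X A) \<delta> = \<zero>\<^bsub>Ext X (src n) A\<^esub>"
      using add_Ext_left_cancel[of C A \<delta> "Emap X n (ident X A) \<delta>" "\<zero>\<^bsub>Ext X C A\<^esub>"] d n by simp
    then obtain s where s: "arr s" "src s = src n" "tgt s = B" "n = y \<cdot> s"
      by (rule factor_through_deflation[OF t n(1,3)])
    have "n \<cdot> y = \<zero>\<^bsub>Hom X B C\<^esub>" using u d unfolding n_def by simp
    then have "n \<cdot> (y \<cdot> s) = \<zero>\<^bsub>Hom X B C\<^esub> \<cdot> s"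
      by (rule cmp_prolong) (use n s(1-3) d in auto)
    also have "\<dots> = \<zero>\<^bsub>Hom X C C\<^esub>" using s(1-3) n d by simp
    finally show "(u \<^bold>+ \<^bold>- ident X C) \<cdot> (u \<^bold>+ \<^bold>- ident X C) = \<zero>\<^bsub>Hom X C C\<^esub>"
      unfolding s(4)[symmetric] n_def .
  qed
  note d = E_triangleD[OF t] and d' = E_triangleD[OF t']
  obtain c where c: "arr c" "src c = C" "tgt c = C'" "y' \<cdot> ident X B = c \<cdot> y"
      "Emap X (ident X C) (ident X A) \<delta> = Emap X c (ident X A) \<delta>'"
    by (rule ET3E[OF t t', of "ident X A" "ident X B"]) (use d in auto)
  obtain c' where c': "arr c'" "src c' = C'" "tgt c' = C" "y \<cdot> ident X B = c' \<cdot> y'"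
      "Emap X (ident X C') (ident X A) \<delta>' = Emap X c' (ident X A) \<delta>"
    by (rule ET3E[OF t' t, of "ident X A" "ident X B"]) (use d' in auto)
  have e: "c \<cdot> y = y'" "c' \<cdot> y' = y" "Emap X c (ident X A) \<delta>' = \<delta>" "Emap X c' (ident X A) \<delta> = \<delta>'"
    using c c' d d' by simp_all
  have "is_iso X (c' \<cdot> c) C C"
  proof (rule unip[OF t])
    have "Emap X (c' \<cdot> c) (ident X A) \<delta> = Emap X c (ident X A) (Emap X c' (ident X A) \<delta>)"
      using c(1-3) c'(1-3) d by simp
    then show "Emap X (c' \<cdot> c) (ident X A) \<delta> = \<delta>" using e by simp
  qed (use c c' d e in auto)
  moreover have "is_iso X (c \<cdot> c') C' C'"
  proof (rule unip[OF t'])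
    have "Emap X (c \<cdot> c') (ident X A) \<delta>' = Emap X c' (ident X A) (Emap X c (ident X A) \<delta>')"
      using c(1-3) c'(1-3) d' by simp
    then show "Emap X (c \<cdot> c') (ident X A) \<delta>' = \<delta>'" using e by simp
  qed (use c c' d' e in auto)
  ultimately have "is_iso X c C C'" by (rule iso_of_iso_composites[OF c(1-3) c'(1-3)])
  then show thesis using that c(1-3) e by blast
qed

end


section \<open>Consequences of (ET4)\<close>

context pre_extriangulated
begin

lemma ET4_imp_ET0:
  assumes "ET4 X"
  shows "ET0 X"
  using assms unfolding ET4_def ET0_def inflation_def by blast

lemma split_triangle_swapped:
  assumes A: "A \<in> Obj X" and C: "C \<in> Obj X"
  shows "E_triangle X A (inj2 X C A) (C \<boxplus> A) (prj1 X C A) C \<zero>\<^bsub>Ext X C A\<^esub>"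
proof (rule E_triangle_iso_middle[OF split_triangle[OF A C]])
  let ?b = "row X A C (C \<boxplus> A) (inj2 X C A) (inj1 X C A)"
  let ?b' = "row X C A (A \<boxplus> C) (inj2 X A C) (inj1 X A C)"
  have "?b' \<cdot> ?b = ident X (A \<boxplus> C)"
    by (rule arr_out_of_dsum_eqI[where A = A and B = C]) (use A C in auto)
  moreover have "?b \<cdot> ?b' = ident X (C \<boxplus> A)"
    by (rule arr_out_of_dsum_eqI[where A = C and B = A]) (use A C in auto)
  ultimately show "is_iso X ?b (A \<boxplus> C) (C \<boxplus> A)"
    using A C by (auto simp: is_iso_iff intro!: exI[of _ ?b'])
  show "prj1 X C A \<cdot> ?b = prj2 X A C"
    by (rule arr_out_of_dsum_eqI[where A = A and B = C]) (use A C in auto)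
qed (use A C in auto)

text \<open>
  (ET4) for a split inflation \<open>i\<close> followed by an inflation \<open>j\<close>. The cone of \<open>j \<cdot> i\<close> realizes
  $q_*\nu$, so it can be replaced by the given realization \<open>B\<close>; its extension is only known
  after pushing it along \<open>i\<close>, and the retraction \<open>p\<close> of \<open>i\<close> recovers it.
\<close>

lemma ET4_split_quotient:
  assumes ET4: "ET4 X"
    and S: "E_triangle X S i P q T \<epsilon>" and p: "arr p" "src p = P" "tgt p = S" "p \<cdot> i = ident X S"
    and N: "E_triangle X P j M k C \<nu>"
    and T: "E_triangle X T x B y C (Emap X (ident X C) q \<nu>)"
  obtains e where "E_triangle X S (j \<cdot> i) M e B (Emap X y p \<nu>)" "e \<cdot> j = x \<cdot> q" "y \<cdot> e = k"
proof -
  note d = E_triangleD[OF S] E_triangleD[OF N] E_triangleD[OF T]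
  have "\<exists>E h h' \<delta>'' d e.
           E_triangle X S h M h' E \<delta>'' \<and> E_triangle X T d E e C (push X C q \<nu>) \<and>
           h = j \<cdot> i \<and> d \<cdot> q = h' \<cdot> j \<and> e \<cdot> h' = k \<and>
           pull X S d \<delta>'' = \<epsilon> \<and> push X E i \<delta>'' = pull X P e \<nu>"
    using ET4 S N unfolding ET4_def by blast
  then obtain E h' \<delta>'' d e where
    H: "E_triangle X S (j \<cdot> i) M h' E \<delta>''" and D: "E_triangle X T d E e C (Emap X (ident X C) q \<nu>)"
    and eqs: "d \<cdot> q = h' \<cdot> j" "e \<cdot> h' = k" "Emap X (ident X E) i \<delta>'' = Emap X e (ident X P) \<nu>"
    by auto
  note dd = E_triangleD[OF H] E_triangleD[OF D]
  obtain b where "is_iso X b E B" and b: "b \<cdot> d = x" "y \<cdot> b = e"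
    using E_triangle_unique_middle[OF D T] by auto
  then obtain b' where b': "arr b" "src b = E" "tgt b = B" "arr b'" "src b' = B" "tgt b' = E"
    "b' \<cdot> b = ident X E" "b \<cdot> b' = ident X B"
    using d dd by (auto simp: is_iso_iff)
  have "e \<cdot> b' = y \<cdot> (b \<cdot> b')" using b(2) b' d by (metis cmp_cmp)
  then have eb': "e \<cdot> b' = y" using b' d by simp
  have "\<delta>'' = Emap X (ident X E) p (Emap X (ident X E) i \<delta>'')" using d dd p by simp
  also have "\<dots> = Emap X e p \<nu>" unfolding eqs(3) using d dd p by simp
  finally have "Emap X b' (ident X S) \<delta>'' = Emap X b' (ident X S) (Emap X e p \<nu>)" by (rule arg_cong)
  also have "\<dots> = Emap X y p \<nu>" using d dd p b' eb' by simp
  finally have "E_triangle X S (j \<cdot> i) M (b \<cdot> h') B (Emap X y p \<nu>)"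
    using E_triangle_iso_third[OF H b'] by simp
  moreover have "(b \<cdot> h') \<cdot> j = x \<cdot> q"
    using b' d dd eqs(1)[symmetric] cmp_prolong[OF b(1), of q] by simp
  moreover have "y \<cdot> (b \<cdot> h') = k" using b' d dd cmp_prolong[OF b(2), of h'] eqs(2) by simp
  ultimately show thesis by (rule that)
qed

lemma ET4_imp_ET4_1:
  assumes ET4: "ET4 X"
  shows "ET4_1 X"
  unfolding ET4_1_def
proof (intro allI impI, elim conjE)
  fix A\<^sub>1 x\<^sub>1 B\<^sub>1 y\<^sub>1 A\<^sub>2 x\<^sub>2 B\<^sub>2 y\<^sub>2 C \<delta>\<^sub>1 \<delta>\<^sub>2
  assume T1: "E_triangle X A\<^sub>1 x\<^sub>1 B\<^sub>1 y\<^sub>1 C \<delta>\<^sub>1" and T2: "E_triangle X A\<^sub>2 x\<^sub>2 B\<^sub>2 y\<^sub>2 C \<delta>\<^sub>2"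
  note d = E_triangleD[OF T1] E_triangleD[OF T2]
  let ?P = "A\<^sub>1 \<boxplus> A\<^sub>2" and ?i1 = "inj1 X A\<^sub>1 A\<^sub>2" and ?i2 = "inj2 X A\<^sub>1 A\<^sub>2"
  let ?p1 = "prj1 X A\<^sub>1 A\<^sub>2" and ?p2 = "prj2 X A\<^sub>1 A\<^sub>2"
  \<comment> \<open>\<open>\<nu>\<close> is the pullback of \<open>\<delta>\<^sub>1 \<oplus> \<delta>\<^sub>2\<close> along the diagonal of \<open>C\<close>.\<close>
  define \<nu> where "\<nu> = Emap X (ident X C) ?i1 \<delta>\<^sub>1 \<oplus>\<^bsub>Ext X C ?P\<^esub> Emap X (ident X C) ?i2 \<delta>\<^sub>2"
  have \<nu>: "\<nu> \<in> carrier (Ext X C ?P)" unfolding \<nu>_def using d by (intro add_Ext) auto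
  have comp: "Emap X c ?p1 \<nu> = Emap X c (ident X A\<^sub>1) \<delta>\<^sub>1" "Emap X c ?p2 \<nu> = Emap X c (ident X A\<^sub>2) \<delta>\<^sub>2"
    if "arr c" "tgt c = C" for c
    unfolding \<nu>_def using that d by simp_all
  have p: "Emap X (ident X C) ?p1 \<nu> = \<delta>\<^sub>1" "Emap X (ident X C) ?p2 \<nu> = \<delta>\<^sub>2"
    using comp[of "ident X C"] d by simp_all
  obtain j M k where N: "E_triangle X ?P j M k C \<nu>"
    by (rule E_triangle_exists[of ?P C \<nu>]) (use d \<nu> in auto)
  note dN = E_triangleD[OF N]
  obtain e\<^sub>1 where e1: "E_triangle X A\<^sub>1 (j \<cdot> ?i1) M e\<^sub>1 B\<^sub>2 (Emap X y\<^sub>2 ?p1 \<nu>)"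
    "e\<^sub>1 \<cdot> j = x\<^sub>2 \<cdot> ?p2" "y\<^sub>2 \<cdot> e\<^sub>1 = k"
    by (rule ET4_split_quotient[OF ET4 split_triangle[of A\<^sub>1 A\<^sub>2] _ _ _ _ N, of ?p1 x\<^sub>2 B\<^sub>2 y\<^sub>2])
      (use d T2 p in auto)
  obtain e\<^sub>2 where e2: "E_triangle X A\<^sub>2 (j \<cdot> ?i2) M e\<^sub>2 B\<^sub>1 (Emap X y\<^sub>1 ?p2 \<nu>)"
    "e\<^sub>2 \<cdot> j = x\<^sub>1 \<cdot> ?p1" "y\<^sub>1 \<cdot> e\<^sub>2 = k"
    by (rule ET4_split_quotient[OF ET4 split_triangle_swapped[of A\<^sub>2 A\<^sub>1] _ _ _ _ N, of ?p2 x\<^sub>1 B\<^sub>1 y\<^sub>1])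
      (use d T1 p in auto)
  note de = E_triangleD[OF e1(1)] E_triangleD[OF e2(1)]
  have "Emap X (ident X C) (j \<cdot> ?i1) \<delta>\<^sub>1 \<oplus>\<^bsub>Ext X C M\<^esub> Emap X (ident X C) (j \<cdot> ?i2) \<delta>\<^sub>2
      = Emap X (ident X C) j \<nu>"
    unfolding \<nu>_def using d dN by simp
  then have "Emap X (ident X C) (j \<cdot> ?i1) \<delta>\<^sub>1 \<oplus>\<^bsub>Ext X C M\<^esub> Emap X (ident X C) (j \<cdot> ?i2) \<delta>\<^sub>2
      = \<zero>\<^bsub>Ext X C M\<^esub>" using E_triangle_push_zero[OF N] by simp
  moreover have "e\<^sub>2 \<cdot> (j \<cdot> ?i1) = x\<^sub>1" "e\<^sub>1 \<cdot> (j \<cdot> ?i2) = x\<^sub>2"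
    using cmp_prolong[OF e2(2), of ?i1] cmp_prolong[OF e1(2), of ?i2] d dN de by simp_all
  ultimately show "\<exists>M m\<^sub>1 e\<^sub>1 m\<^sub>2 e\<^sub>2.
           E_triangle X A\<^sub>1 m\<^sub>1 M e\<^sub>1 B\<^sub>2 (pull X A\<^sub>1 y\<^sub>2 \<delta>\<^sub>1) \<and>
           E_triangle X A\<^sub>2 m\<^sub>2 M e\<^sub>2 B\<^sub>1 (pull X A\<^sub>2 y\<^sub>1 \<delta>\<^sub>2) \<and>
           e\<^sub>2 \<cdot> m\<^sub>1 = x\<^sub>1 \<and> e\<^sub>1 \<cdot> m\<^sub>2 = x\<^sub>2 \<and> y\<^sub>2 \<cdot> e\<^sub>1 = y\<^sub>1 \<cdot> e\<^sub>2 \<and>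
           push X C m\<^sub>1 \<delta>\<^sub>1 \<oplus>\<^bsub>Ext X C M\<^esub> push X C m\<^sub>2 \<delta>\<^sub>2 = \<zero>\<^bsub>Ext X C M\<^esub>"
    using e1 e2 comp(1)[of y\<^sub>2] comp(2)[of y\<^sub>1] d
    by (intro exI[of _ M] exI[of _ "j \<cdot> ?i1"] exI[of _ e\<^sub>1] exI[of _ "j \<cdot> ?i2"] exI[of _ e\<^sub>2]) simp
qed

section \<open>Correcting triangles by shear automorphisms\<close>

text \<open>The automorphism $1 - \mathrm{in}_1\, t\, \mathrm{pr}_2$ of $P \oplus Q$ changes only the first
  component of the inflation and the second component of the deflation.\<close>

lemma E_triangle_shear:
  assumes T: "E_triangle X A x (P \<boxplus> Q) y C \<delta>" and P: "P \<in> Obj X" and Q: "Q \<in> Obj X"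
    and t: "arr t" "src t = Q" "tgt t = P"
  shows "E_triangle X A (col X A P Q (prj1 X P Q \<cdot> x \<^bold>+ \<^bold>- (t \<cdot> (prj2 X P Q \<cdot> x))) (prj2 X P Q \<cdot> x)) (P \<boxplus> Q)
    (row X P Q C (y \<cdot> inj1 X P Q) (y \<cdot> inj2 X P Q \<^bold>+ y \<cdot> (inj1 X P Q \<cdot> t))) C \<delta>"
proof (rule E_triangle_iso_middle[OF T])
  note d = E_triangleD[OF T]
  define n where "n = inj1 X P Q \<cdot> (t \<cdot> prj2 X P Q)"
  let ?b = "ident X (P \<boxplus> Q) \<^bold>+ \<^bold>- n"
  have n: "arr n" "src n = P \<boxplus> Q" "tgt n = P \<boxplus> Q" unfolding n_def using t P Q by simp_all
  have nn: "n \<cdot> n = \<zero>\<^bsub>Hom X (P \<boxplus> Q) (P \<boxplus> Q)\<^esub>" unfolding n_def using t P Q by simp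
  have "?b \<^bold>+ \<^bold>- ident X (P \<boxplus> Q) = \<^bold>- n"
    using n P Q add_arr_commute[of ?b "\<^bold>- ident X (P \<boxplus> Q)"] by simp
  then show "is_iso X ?b (P \<boxplus> Q) (P \<boxplus> Q)"
    by (intro unipotent_iso) (use n nn P Q in simp_all)
  show "?b \<cdot> x = col X A P Q (prj1 X P Q \<cdot> x \<^bold>+ \<^bold>- (t \<cdot> (prj2 X P Q \<cdot> x))) (prj2 X P Q \<cdot> x)"
    by (rule arr_into_dsum_eqI[where A = P and B = Q]) (use n d t P Q in \<open>simp_all add: n_def\<close>)
  show "row X P Q C (y \<cdot> inj1 X P Q) (y \<cdot> inj2 X P Q \<^bold>+ y \<cdot> (inj1 X P Q \<cdot> t)) \<cdot> ?b = y"
    by (rule arr_out_of_dsum_eqI[where A = P and B = Q])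
      (use n d t P Q in \<open>simp_all add: n_def add_arr_assoc\<close>)
qed (use E_triangleD[OF T] t P Q in simp_all)

lemma ET4_1_imp_ET4_5:
  assumes ET4_1: "ET4_1 X"
  shows "ET4_5 X"
  unfolding ET4_5_def
proof (intro allI impI, elim conjE)
  fix A\<^sub>1 x\<^sub>1 B\<^sub>1 y\<^sub>1 A\<^sub>2 x\<^sub>2 B\<^sub>2 y\<^sub>2 C \<delta> \<delta>' g
  assume T1: "E_triangle X A\<^sub>1 x\<^sub>1 B\<^sub>1 y\<^sub>1 C \<delta>" and T2: "E_triangle X A\<^sub>2 x\<^sub>2 B\<^sub>2 y\<^sub>2 C \<delta>'"
    and "g \<in> carrier (Hom X B\<^sub>1 B\<^sub>2)" and yg: "y\<^sub>2 \<cdot> g = y\<^sub>1"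
  note d = E_triangleD[OF T1] E_triangleD[OF T2]
  have g: "arr g" "src g = B\<^sub>1" "tgt g = B\<^sub>2" using \<open>g \<in> _\<close> d by auto
  let ?S = "A\<^sub>2 \<boxplus> B\<^sub>1" and ?i1 = "inj1 X A\<^sub>2 B\<^sub>1" and ?i2 = "inj2 X A\<^sub>2 B\<^sub>1"
  let ?p1 = "prj1 X A\<^sub>2 B\<^sub>1" and ?p2 = "prj2 X A\<^sub>2 B\<^sub>1"
  have "\<exists>M m\<^sub>1 e\<^sub>1 m\<^sub>2 e\<^sub>2.
           E_triangle X A\<^sub>1 m\<^sub>1 M e\<^sub>1 B\<^sub>2 (pull X A\<^sub>1 y\<^sub>2 \<delta>) \<and>
           E_triangle X A\<^sub>2 m\<^sub>2 M e\<^sub>2 B\<^sub>1 (pull X A\<^sub>2 y\<^sub>1 \<delta>') \<and>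
           e\<^sub>2 \<cdot> m\<^sub>1 = x\<^sub>1 \<and> e\<^sub>1 \<cdot> m\<^sub>2 = x\<^sub>2 \<and> y\<^sub>2 \<cdot> e\<^sub>1 = y\<^sub>1 \<cdot> e\<^sub>2 \<and>
           push X C m\<^sub>1 \<delta> \<oplus>\<^bsub>Ext X C M\<^esub> push X C m\<^sub>2 \<delta>' = \<zero>\<^bsub>Ext X C M\<^esub>"
    using ET4_1 T1 T2 unfolding ET4_1_def by blast
  then obtain M m\<^sub>1 e\<^sub>1 m\<^sub>2 e\<^sub>2 where
    M1: "E_triangle X A\<^sub>1 m\<^sub>1 M e\<^sub>1 B\<^sub>2 (Emap X y\<^sub>2 (ident X A\<^sub>1) \<delta>)" and
    M2: "E_triangle X A\<^sub>2 m\<^sub>2 M e\<^sub>2 B\<^sub>1 (Emap X y\<^sub>1 (ident X A\<^sub>2) \<delta>')" and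
    eqs: "e\<^sub>2 \<cdot> m\<^sub>1 = x\<^sub>1" "e\<^sub>1 \<cdot> m\<^sub>2 = x\<^sub>2" "y\<^sub>2 \<cdot> e\<^sub>1 = y\<^sub>1 \<cdot> e\<^sub>2" and
    sum0: "Emap X (ident X C) m\<^sub>1 \<delta> \<oplus>\<^bsub>Ext X C M\<^esub> Emap X (ident X C) m\<^sub>2 \<delta>' = \<zero>\<^bsub>Ext X C M\<^esub>"
    by auto
  note dM = E_triangleD[OF M1] E_triangleD[OF M2]
  have "Emap X y\<^sub>1 (ident X A\<^sub>2) \<delta>' = Emap X g (ident X A\<^sub>2) (Emap X y\<^sub>2 (ident X A\<^sub>2) \<delta>')"
    using g yg d by simp
  also have "\<dots> = \<zero>\<^bsub>Ext X B\<^sub>1 A\<^sub>2\<^esub>" unfolding E_triangle_pull_zero[OF T2] using g d by simp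
  finally have M2': "E_triangle X A\<^sub>2 m\<^sub>2 M e\<^sub>2 B\<^sub>1 \<zero>\<^bsub>Ext X B\<^sub>1 A\<^sub>2\<^esub>" using M2 by simp
  \<comment> \<open>Since \<open>M\<close> realizes a split extension, it is the direct sum of \<open>A\<^sub>2\<close> and \<open>B\<^sub>1\<close>.\<close>
  obtain b where b: "is_iso X b ?S M" "b \<cdot> ?i1 = m\<^sub>2" "e\<^sub>2 \<cdot> b = ?p2"
    using E_triangle_unique_middle[OF split_triangle[OF d(11) d(2)] M2'] by auto
  then obtain b' where b': "arr b" "src b = ?S" "tgt b = M" "arr b'" "src b' = M" "tgt b' = ?S"
    "b' \<cdot> b = ident X ?S" "b \<cdot> b' = ident X M"
    using d dM by (auto simp: is_iso_iff)
  have S: "E_triangle X A\<^sub>1 (b' \<cdot> m\<^sub>1) ?S (e\<^sub>1 \<cdot> b) B\<^sub>2 (Emap X y\<^sub>2 (ident X A\<^sub>1) \<delta>)"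
  proof (rule E_triangle_iso_middle[OF M1])
    show "is_iso X b' M ?S" using b' d dM by (auto simp: is_iso_iff)
  qed (use b' d dM in auto)
  have pm: "?p2 \<cdot> (b' \<cdot> m\<^sub>1) = x\<^sub>1"
    using b(3)[symmetric] eqs(1) cmp_prolong[OF b'(8), of m\<^sub>1] b' d dM by simp
  have em: "e\<^sub>1 \<cdot> (b \<cdot> ?i1) = x\<^sub>2" using b(2) eqs(2) by simp
  \<comment> \<open>The second component of the deflation and \<open>g\<close> agree after composing with \<open>y\<^sub>2\<close>, so they differ
    by a morphism through \<open>x\<^sub>2\<close>, which a shear removes.\<close>
  define g\<^sub>1 where "g\<^sub>1 = e\<^sub>1 \<cdot> (b \<cdot> ?i2)"
  have g1: "arr g\<^sub>1" "src g\<^sub>1 = B\<^sub>1" "tgt g\<^sub>1 = B\<^sub>2" unfolding g\<^sub>1_def using b' d dM by simp_all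
  have "y\<^sub>2 \<cdot> g\<^sub>1 = y\<^sub>1"
    unfolding g\<^sub>1_def using cmp_prolong[OF eqs(3), of "b \<cdot> ?i2"] cmp_prolong[OF b(3), of ?i2] b' d dM
    by simp
  then have "y\<^sub>2 \<cdot> (g \<^bold>+ \<^bold>- g\<^sub>1) = \<zero>\<^bsub>Hom X (src (g \<^bold>+ \<^bold>- g\<^sub>1)) C\<^esub>" using g g1 yg d by simp
  then obtain t where t: "arr t" "src t = src (g \<^bold>+ \<^bold>- g\<^sub>1)" "tgt t = A\<^sub>2" "g \<^bold>+ \<^bold>- g\<^sub>1 = x\<^sub>2 \<cdot> t"
    by (rule factor_through_inflation[OF T2, rotated 2]) (use g g1 in auto)
  have t2: "src t = B\<^sub>1" using t(2) g g1 by simp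
  have gt: "g\<^sub>1 \<^bold>+ x\<^sub>2 \<cdot> t = g"
    unfolding t(4)[symmetric] using g g1 add_arr_commute[of g\<^sub>1 "g \<^bold>+ \<^bold>- g\<^sub>1"] by (simp add: add_arr_assoc)
  define u where "u = ?p1 \<cdot> (b' \<cdot> m\<^sub>1)"
  have u: "arr u" "src u = A\<^sub>1" "tgt u = A\<^sub>2" unfolding u_def using b' d dM by simp_all
  define f where "f = t \<cdot> x\<^sub>1 \<^bold>+ \<^bold>- u"
  have f: "arr f" "src f = A\<^sub>1" "tgt f = A\<^sub>2" unfolding f_def using u t(1,3) t2 d by simp_all
  have "\<^bold>- f = u \<^bold>+ \<^bold>- (t \<cdot> x\<^sub>1)"
    unfolding f_def using u t(1,3) t2 d add_arr_commute[of u "\<^bold>- (t \<cdot> x\<^sub>1)"] by (simp add: neg_add_arr)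
  then have S': "E_triangle X A\<^sub>1 (col X A\<^sub>1 A\<^sub>2 B\<^sub>1 (\<^bold>- f) x\<^sub>1) ?S (row X A\<^sub>2 B\<^sub>1 B\<^sub>2 x\<^sub>2 g) B\<^sub>2
      (Emap X y\<^sub>2 (ident X A\<^sub>1) \<delta>)"
    using E_triangle_shear[OF S d(11) d(2) t(1) t2 t(3)] gt cmp_prolong[OF em, of t] t(1,3) t2 b' d dM
    by (simp add: pm em u_def g\<^sub>1_def)
  have "x\<^sub>2 \<cdot> \<^bold>- f \<^bold>+ g \<cdot> x\<^sub>1 = \<zero>\<^bsub>Hom X A\<^sub>1 B\<^sub>2\<^esub>"
    using E_triangle_cmp_zero[OF S'] f g d by simp
  then have xf: "x\<^sub>2 \<cdot> f = g \<cdot> x\<^sub>1"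
    using neg_arr_unique[of "\<^bold>- (x\<^sub>2 \<cdot> f)" "g \<cdot> x\<^sub>1"] f g d by simp
  have pb: "?p1 \<cdot> (b' \<cdot> m\<^sub>2) = ident X A\<^sub>2"
    using cmp_prolong[OF b'(7), of ?i1] b' d dM by (simp flip: b(2))
  \<comment> \<open>The relation between the two extensions over \<open>M\<close>, projected to \<open>A\<^sub>2\<close>, says that \<open>-u\<close> carries \<open>\<delta>\<close>
    to \<open>\<delta>'\<close>; the summand of \<open>f\<close> through \<open>x\<^sub>1\<close> kills \<open>\<delta>\<close>.\<close>
  have "Emap X (ident X C) (?p1 \<cdot> b') (Emap X (ident X C) m\<^sub>1 \<delta> \<oplus>\<^bsub>Ext X C M\<^esub> Emap X (ident X C) m\<^sub>2 \<delta>')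
      = Emap X (ident X C) (?p1 \<cdot> b') \<zero>\<^bsub>Ext X C M\<^esub>" by (simp only: sum0)
  then have 1: "Emap X (ident X C) u \<delta> \<oplus>\<^bsub>Ext X C A\<^sub>2\<^esub> \<delta>' = \<zero>\<^bsub>Ext X C A\<^sub>2\<^esub>"
    using b' d dM pb by (simp flip: u_def)
  have 2: "Emap X (ident X C) u \<delta> \<oplus>\<^bsub>Ext X C A\<^sub>2\<^esub> Emap X (ident X C) (\<^bold>- u) \<delta> = \<zero>\<^bsub>Ext X C A\<^sub>2\<^esub>"
    using Emap_add_arr(2)[of "ident X C" u "\<^bold>- u" \<delta>] u d by simp
  have 3: "Emap X (ident X C) (\<^bold>- u) \<delta> = \<delta>'"
    by (rule add_Ext_left_cancel[of C A\<^sub>2 "Emap X (ident X C) u \<delta>"]) (use 1 2 u d in simp_all)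
  have "Emap X (ident X C) (t \<cdot> x\<^sub>1) \<delta> = Emap X (ident X C) t (Emap X (ident X C) x\<^sub>1 \<delta>)"
    using t(1,3) t2 d by simp
  also have "\<dots> = \<zero>\<^bsub>Ext X C A\<^sub>2\<^esub>" unfolding E_triangle_push_zero[OF T1] using t(1,3) t2 d by simp
  finally have "Emap X (ident X C) f \<delta> = \<delta>'"
    unfolding f_def using 3 u t(1,3) t2 d by simp
  then show "\<exists>f. E_triangle_morphism X A\<^sub>1 x\<^sub>1 B\<^sub>1 y\<^sub>1 C \<delta> A\<^sub>2 x\<^sub>2 B\<^sub>2 y\<^sub>2 C \<delta>' f g (ident X C) \<and>
             E_triangle X A\<^sub>1 (col X A\<^sub>1 A\<^sub>2 B\<^sub>1 (\<ominus>\<^bsub>Hom X A\<^sub>1 A\<^sub>2\<^esub> f) x\<^sub>1) (A\<^sub>2 \<boxplus> B\<^sub>1)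
                          (row X A\<^sub>2 B\<^sub>1 B\<^sub>2 x\<^sub>2 g) B\<^sub>2 (pull X A\<^sub>1 y\<^sub>2 \<delta>)"
    using S' T1 T2 f g xf yg d by (intro exI[of _ f]) (simp add: E_triangle_morphism_def)
qed

lemma ET4_5_imp_ET4_2:
  assumes ET4_5: "ET4_5 X"
  shows "ET4_2 X"
  unfolding ET4_2_def
proof (intro allI impI, elim conjE)
  fix A x B y C \<delta> D f d E e
  assume T: "E_triangle X A x B y C \<delta>" and D: "D \<in> Obj X" and "f \<in> carrier (Hom X A D)"
    and "E_triangle X D d E e C (push X C f \<delta>)"
  then have T': "E_triangle X D d E e C (Emap X (ident X C) f \<delta>)" by simp
  note d = E_triangleD[OF T] E_triangleD[OF T']
  have f: "arr f" "src f = A" "tgt f = D" using \<open>f \<in> _\<close> d by auto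
  obtain g\<^sub>0 where g0: "arr g\<^sub>0" "src g\<^sub>0 = B" "tgt g\<^sub>0 = E" "g\<^sub>0 \<cdot> x = d \<cdot> f" "e \<cdot> g\<^sub>0 = ident X C \<cdot> y"
    by (rule realize_morphismE[OF T T', of f "ident X C"]) (use f d in auto)
  have eg0: "e \<cdot> g\<^sub>0 = y" "g\<^sub>0 \<in> carrier (Hom X B E)" using g0 d by auto
  obtain f\<^sub>0 where
    m: "E_triangle_morphism X A x B y C \<delta> D d E e C (Emap X (ident X C) f \<delta>) f\<^sub>0 g\<^sub>0 (ident X C)"
    and S0: "E_triangle X A (col X A D B (\<ominus>\<^bsub>Hom X A D\<^esub> f\<^sub>0) x) (D \<boxplus> B)
      (row X D B E d g\<^sub>0) E (pull X A e \<delta>)"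
    using ET4_5 T T' eg0 unfolding ET4_5_def by blast
  have f0: "arr f\<^sub>0" "src f\<^sub>0 = A" "tgt f\<^sub>0 = D" "g\<^sub>0 \<cdot> x = d \<cdot> f\<^sub>0"
    and "Emap X (ident X C) f\<^sub>0 \<delta> = Emap X (ident X C) (ident X D) (Emap X (ident X C) f \<delta>)"
    using m d unfolding E_triangle_morphism_def by simp_all
  then have f0\<delta>: "Emap X (ident X C) f\<^sub>0 \<delta> = Emap X (ident X C) f \<delta>" using f d by simp
  have S: "E_triangle X A (col X A D B (\<^bold>- f\<^sub>0) x) (D \<boxplus> B) (row X D B E d g\<^sub>0) E
      (Emap X e (ident X A) \<delta>)" using S0 f0 by simp
  \<comment> \<open>(ET4-5) yields some \<open>f\<^sub>0\<close> with the same effect on \<open>\<delta>\<close> as \<open>f\<close>; the difference extends along \<open>x\<close>,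
    and shearing by the extended morphism turns \<open>f\<^sub>0\<close> into \<open>f\<close>.\<close>
  define n where "n = f \<^bold>+ \<^bold>- f\<^sub>0"
  have n: "arr n" "src n = A" "tgt n = D" unfolding n_def using f f0 by simp_all
  have fn: "f = f\<^sub>0 \<^bold>+ n"
    unfolding n_def using f f0 add_arr_commute[of f\<^sub>0 "f \<^bold>+ \<^bold>- f\<^sub>0"] by (simp add: add_arr_assoc)
  have "Emap X (ident X C) n \<delta> = \<zero>\<^bsub>Ext X C (tgt n)\<^esub>"
    by (rule add_Ext_left_cancel[of C D "Emap X (ident X C) f\<^sub>0 \<delta>"])
      (use f0(1-3) f0\<delta>[unfolded fn] n d in simp_all)
  then obtain k where k: "arr k" "src k = B" "tgt k = tgt n" "n = k \<cdot> x"
    by (rule extend_along_inflation[OF T n(1,2)])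
  have k3: "tgt k = D" using k(3) n(3) by simp
  define g where "g = g\<^sub>0 \<^bold>+ d \<cdot> k"
  have g: "arr g" "src g = B" "tgt g = E" unfolding g_def using g0(1-3) k(1,2) k3 d by simp_all
  have "\<^bold>- f\<^sub>0 \<^bold>+ \<^bold>- (k \<cdot> x) = \<^bold>- f" unfolding k(4)[symmetric] fn using f0 n by (simp add: neg_add_arr)
  then have S': "E_triangle X A (col X A D B (\<^bold>- f) x) (D \<boxplus> B) (row X D B E d g) E
      (Emap X e (ident X A) \<delta>)"
    using E_triangle_shear[OF S D d(2) k(1,2) k3] f0 g0 k(1,2) k3 d by (simp add: g_def)
  have "g \<cdot> x = d \<cdot> f"
    unfolding g_def fn using f0 g0(1-3) k(1,2) k3 k(4)[symmetric] n d by simp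
  moreover have "e \<cdot> (d \<cdot> k) = \<zero>\<^bsub>Hom X B C\<^esub>"
    using cmp_prolong[OF E_triangle_cmp_zero[OF T'], of k] k(1,2) k3 d by simp
  then have "e \<cdot> g = y" unfolding g_def using eg0(1) g0(1-3) k(1,2) k3 d by simp
  ultimately show "\<exists>g. E_triangle_morphism X A x B y C \<delta> D d E e C (push X C f \<delta>) f g (ident X C) \<and>
             E_triangle X A (col X A D B (\<ominus>\<^bsub>Hom X A D\<^esub> f) x) (D \<boxplus> B) (row X D B E d g) E
                          (pull X A e \<delta>)"
    using S' T T' f g d by (intro exI[of _ g]) (simp add: E_triangle_morphism_def)
qed

section \<open>Cobase change and the octahedron\<close>

text \<open>The sum of a triangle with $0 \to C \to C$, with $A \oplus 0$ replaced by \<open>A\<close>. Any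
  realization \<open>R\<close> of $\mathrm{pr}_1^*\delta$ maps to \<open>B\<close>, receives a map from \<open>B\<close>, and receives one from
  \<open>C\<close> because $\mathrm{pr}_1^*\delta$ pulls back to zero there; these assemble to the two comparison morphisms.\<close>

lemma E_triangle_add_identity:
  assumes T: "E_triangle X A f B f' D \<delta>" and C: "C \<in> Obj X"
  shows "E_triangle X A (inj1 X B C \<cdot> f) (B \<boxplus> C)
    (row X B C (D \<boxplus> C) (inj1 X D C \<cdot> f') (inj2 X D C)) (D \<boxplus> C) (Emap X (prj1 X D C) (ident X A) \<delta>)"
proof -
  note d = E_triangleD[OF T]
  let ?S = "D \<boxplus> C" and ?\<eta> = "Emap X (prj1 X D C) (ident X A) \<delta>"
  let ?\<pi> = "row X B C (D \<boxplus> C) (inj1 X D C \<cdot> f') (inj2 X D C)"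
  obtain x R y where R: "E_triangle X A x R y ?S ?\<eta>"
    by (rule E_triangle_exists[of A ?S ?\<eta>]) (use d C in auto)
  note dR = E_triangleD[OF R]
  obtain r where r: "arr r" "src r = R" "tgt r = B" "r \<cdot> x = f \<cdot> ident X A" "f' \<cdot> r = prj1 X D C \<cdot> y"
    by (rule realize_morphismE[OF R T, of "ident X A" "prj1 X D C"]) (use d C in auto)
  obtain i where i: "arr i" "src i = B" "tgt i = R" "i \<cdot> f = x \<cdot> ident X A" "y \<cdot> i = inj1 X D C \<cdot> f'"
    by (rule realize_morphismE[OF T R, of "ident X A" "inj1 X D C"]) (use d C in auto)
  have "Emap X (inj2 X D C) (ident X A) ?\<eta> = \<zero>\<^bsub>Ext X (src (inj2 X D C)) A\<^esub>" using d C by simp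
  then obtain s where s: "arr s" "src s = src (inj2 X D C)" "tgt s = R" "inj2 X D C = y \<cdot> s"
    by (rule factor_through_deflation[OF R, rotated 2]) (use d C in auto)
  have s2: "src s = C" using s(2) d C by simp
  have ys: "y \<cdot> s = inj2 X D C" using s(4) by simp
  note s' = s(1) s2 s(3) ys
  let ?p = "col X R B C r (prj2 X D C \<cdot> y)" and ?q = "row X B C R i s"
  show ?thesis
  proof (rule E_triangle_by_comparison[OF R, where p = ?p and q = ?q])
    have pyx: "prj2 X D C \<cdot> (y \<cdot> x) = \<zero>\<^bsub>Hom X A C\<^esub>" using E_triangle_cmp_zero[OF R] d C by simp
    show "?p \<cdot> x = inj1 X B C \<cdot> f"
      by (rule arr_into_dsum_eqI[where A = B and B = C]) (use d dR C r pyx in simp_all)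
    have "prj1 X D C \<cdot> (?\<pi> \<cdot> w) = f' \<cdot> (prj1 X B C \<cdot> w)" "prj2 X D C \<cdot> (?\<pi> \<cdot> w) = prj2 X B C \<cdot> w"
      if "arr w" "tgt w = B \<boxplus> C" for w
      using that d C by (simp_all add: row_def)
    note \<pi> = this
    show "?\<pi> \<cdot> ?p = y"
      by (rule arr_into_dsum_eqI[where A = D and B = C]) (use d dR C r in \<open>simp_all add: \<pi>\<close>)
    show "?q \<cdot> (inj1 X B C \<cdot> f) = x" using d dR C i s' by simp
    show "y \<cdot> ?q = ?\<pi>"
      by (rule arr_out_of_dsum_eqI[where A = B and B = C]) (use d dR C i s' in simp_all)
    show "\<exists>t. arr t \<and> src t = B \<boxplus> C \<and> tgt t = A \<and> w = (inj1 X B C \<cdot> f) \<cdot> t"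
      if w: "arr w" "src w = B \<boxplus> C" "tgt w = B \<boxplus> C" "?\<pi> \<cdot> w = \<zero>\<^bsub>Hom X (B \<boxplus> C) (D \<boxplus> C)\<^esub>" for w
    proof -
      have w1: "f' \<cdot> (prj1 X B C \<cdot> w) = \<zero>\<^bsub>Hom X (src (prj1 X B C \<cdot> w)) D\<^esub>"
        using \<pi>(1)[OF w(1,3)] w(1-3) d C unfolding w(4) by simp
      have w2: "prj2 X B C \<cdot> w = \<zero>\<^bsub>Hom X (B \<boxplus> C) C\<^esub>"
        using \<pi>(2)[OF w(1,3)] w(1-3) d C unfolding w(4) by simp
      have pw: "arr (prj1 X B C \<cdot> w)" "tgt (prj1 X B C \<cdot> w) = B" using w(1-3) d C by simp_all
      obtain t where t: "arr t" "src t = src (prj1 X B C \<cdot> w)" "tgt t = A" "prj1 X B C \<cdot> w = f \<cdot> t"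
        by (rule factor_through_inflation[OF T pw w1])
      have t2: "src t = B \<boxplus> C" using t(2) w(1-3) d C by simp
      have "w = inj1 X B C \<cdot> (f \<cdot> t)"
        by (rule arr_into_dsum_eqI[where A = B and B = C])
          (use w(1-3) w2 t(1,3,4) t2 d C in simp_all)
      then show ?thesis using t(1,3) t2 d C by (intro exI[of _ t]) simp
    qed
  qed (use d dR C r i s' in simp_all)
qed

lemma ET4_2E:
  assumes ET4_2: "ET4_2 X" and T: "E_triangle X A x B y C \<delta>"
    and f: "arr f" "src f = A" "tgt f = D"
    and T': "E_triangle X D d E e C (Emap X (ident X C) f \<delta>)"
  obtains g where "arr g" "src g = B" "tgt g = E" "g \<cdot> x = d \<cdot> f" "e \<cdot> g = y"
    "E_triangle X A (col X A D B (\<^bold>- f) x) (D \<boxplus> B) (row X D B E d g) E (Emap X e (ident X A) \<delta>)"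
proof -
  note d = E_triangleD[OF T] E_triangleD[OF T']
  have "f \<in> carrier (Hom X A D)" "E_triangle X D d E e C (push X C f \<delta>)" using f T' d by simp_all
  then obtain g where
    m: "E_triangle_morphism X A x B y C \<delta> D d E e C (push X C f \<delta>) f g (ident X C)"
    and S: "E_triangle X A (col X A D B (\<ominus>\<^bsub>Hom X A D\<^esub> f) x) (D \<boxplus> B) (row X D B E d g) E
      (pull X A e \<delta>)"
    using ET4_2 T d(11) unfolding ET4_2_def by blast
  have "arr g" "src g = B" "tgt g = E" "g \<cdot> x = d \<cdot> f" "e \<cdot> g = y"
    using m d unfolding E_triangle_morphism_def by simp_all
  moreover have "E_triangle X A (col X A D B (\<^bold>- f) x) (D \<boxplus> B) (row X D B E d g) E
      (Emap X e (ident X A) \<delta>)" using S f by simp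
  ultimately show thesis by (rule that)
qed

text \<open>
  The square on \<open>f'\<close>, \<open>g\<close>, \<open>h\<^sub>0\<close>, \<open>d\<^sub>0\<close> is homotopy cartesian. Apply (ET4-2) to the triangle over
  \<open>g \<cdot> f\<close> and to \<open>f\<close>: if \<open>B \<rightarrow> Q \<rightarrow> E\<^sub>0\<close> realizes $f_*\delta_h$, then \<open>Q\<close> is a cone of
  $\binom{-f}{gf} : A \to B \oplus C$. An automorphism of $B \oplus C$ turns this column into
  $\binom{f}{0}$, whose cone is $D \oplus C$. Hence $Q \cong D \oplus C$, and \<open>B \<rightarrow> Q \<rightarrow> E\<^sub>0\<close> becomes
  the triangle claimed.
\<close>

lemma ET4_2_cobase_change:
  assumes ET4_2: "ET4_2 X" and Tf: "E_triangle X A f B f' D \<delta>\<^sub>f"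
    and g: "arr g" "src g = B" "tgt g = C"
    and Th: "E_triangle X A (g \<cdot> f) C h\<^sub>0 E\<^sub>0 \<delta>\<^sub>h"
  obtains d\<^sub>0 where "arr d\<^sub>0" "src d\<^sub>0 = D" "tgt d\<^sub>0 = E\<^sub>0"
    "E_triangle X B (col X B D C (\<^bold>- f') g) (D \<boxplus> C) (row X D C E\<^sub>0 d\<^sub>0 h\<^sub>0) E\<^sub>0 (Emap X (ident X E\<^sub>0) f \<delta>\<^sub>h)"
    "Emap X d\<^sub>0 (ident X A) \<delta>\<^sub>h = \<delta>\<^sub>f"
proof -
  note d = E_triangleD[OF Tf] E_triangleD[OF Th]
  let ?\<epsilon> = "Emap X (ident X E\<^sub>0) f \<delta>\<^sub>h"
  obtain q Q p where TQ: "E_triangle X B q Q p E\<^sub>0 ?\<epsilon>"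
    by (rule E_triangle_exists[of B E\<^sub>0 ?\<epsilon>]) (use d in auto)
  note dQ = E_triangleD[OF TQ]
  obtain r where r: "arr r" "src r = C" "tgt r = Q" "p \<cdot> r = h\<^sub>0"
    and T1: "E_triangle X A (col X A B C (\<^bold>- f) (g \<cdot> f)) (B \<boxplus> C) (row X B C Q q r) Q
      (Emap X p (ident X A) \<delta>\<^sub>h)"
    using ET4_2E[OF ET4_2 Th d(4-6) TQ] by metis
  let ?\<pi> = "row X B C (D \<boxplus> C) (inj1 X D C \<cdot> f') (inj2 X D C)"
  \<comment> \<open>In matrix form \<open>b\<close> has rows \<open>(-1, 0)\<close> and \<open>(g, 1)\<close>; it is an involution and exchanges the columns
    \<open>(f, 0)\<close> and \<open>(-f, g \<cdot> f)\<close>.\<close>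
  define b where "b = row X B C (B \<boxplus> C) (inj2 X B C \<cdot> g \<^bold>+ \<^bold>- inj1 X B C) (inj2 X B C)"
  have b: "arr b" "src b = B \<boxplus> C" "tgt b = B \<boxplus> C" unfolding b_def using d g by simp_all
  have bi: "b \<cdot> inj1 X B C = inj2 X B C \<cdot> g \<^bold>+ \<^bold>- inj1 X B C" "b \<cdot> inj2 X B C = inj2 X B C"
    unfolding b_def using d g by simp_all
  have bi': "b \<cdot> (inj2 X B C \<cdot> g) = inj2 X B C \<cdot> g" using cmp_prolong[OF bi(2), of g] b d g by simp
  have "b \<cdot> b = ident X (B \<boxplus> C)"
    by (rule arr_out_of_dsum_eqI[where A = B and B = C])
      (use b d g in \<open>simp_all add: bi bi' neg_add_arr\<close>)
  then have biso: "is_iso X b (B \<boxplus> C) (B \<boxplus> C)" using b d by (auto simp: is_iso_iff)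
  have T3: "E_triangle X A (col X A B C (\<^bold>- f) (g \<cdot> f)) (B \<boxplus> C) (?\<pi> \<cdot> b) (D \<boxplus> C)
      (Emap X (prj1 X D C) (ident X A) \<delta>\<^sub>f)"
  proof (rule E_triangle_iso_middle[OF E_triangle_add_identity[OF Tf d(12)] biso])
    have "b \<cdot> (inj1 X B C \<cdot> f) = inj2 X B C \<cdot> (g \<cdot> f) \<^bold>+ \<^bold>- (inj1 X B C \<cdot> f)"
      using cmp_prolong[OF bi(1), of f] b d g by simp
    then show "b \<cdot> (inj1 X B C \<cdot> f) = col X A B C (\<^bold>- f) (g \<cdot> f)"
      using add_arr_commute[of "inj2 X B C \<cdot> (g \<cdot> f)" "\<^bold>- (inj1 X B C \<cdot> f)"] d g by (simp add: col_def)
    show "(?\<pi> \<cdot> b) \<cdot> b = ?\<pi>" using \<open>b \<cdot> b = _\<close> b d by simp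
  qed (use b d g in simp_all)
  obtain c where "is_iso X c (D \<boxplus> C) Q" and c: "arr c" "src c = D \<boxplus> C" "tgt c = Q"
    and c\<pi>: "c \<cdot> (?\<pi> \<cdot> b) = row X B C Q q r"
    and c\<delta>: "Emap X c (ident X A) (Emap X p (ident X A) \<delta>\<^sub>h) = Emap X (prj1 X D C) (ident X A) \<delta>\<^sub>f"
    by (rule cone_unique[OF T3 T1])
  then obtain c' where c': "arr c'" "src c' = Q" "tgt c' = D \<boxplus> C" "c' \<cdot> c = ident X (D \<boxplus> C)"
    "c \<cdot> c' = ident X Q" using d dQ by (auto simp: is_iso_iff)
  have "(c \<cdot> (?\<pi> \<cdot> b)) \<cdot> inj2 X B C = r" unfolding c\<pi> using r d dQ by simp
  then have cr: "c \<cdot> inj2 X D C = r" using c b d by (simp add: bi)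
  have "(c \<cdot> (?\<pi> \<cdot> b)) \<cdot> inj1 X B C = q" unfolding c\<pi> using r d dQ by simp
  then have "c \<cdot> (inj2 X D C \<cdot> g) \<^bold>+ \<^bold>- (c \<cdot> (inj1 X D C \<cdot> f')) = q"
    using c b d g by (simp add: bi)
  then have cq: "c \<cdot> col X B D C (\<^bold>- f') g = q"
    using add_arr_commute[of "c \<cdot> (inj2 X D C \<cdot> g)" "\<^bold>- (c \<cdot> (inj1 X D C \<cdot> f'))"] c d g
    by (simp add: col_def)
  define d\<^sub>0 where "d\<^sub>0 = p \<cdot> (c \<cdot> inj1 X D C)"
  have d0: "arr d\<^sub>0" "src d\<^sub>0 = D" "tgt d\<^sub>0 = E\<^sub>0" unfolding d\<^sub>0_def using c d dQ by simp_all
  have pc: "row X D C E\<^sub>0 d\<^sub>0 h\<^sub>0 = p \<cdot> c"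
    by (rule arr_out_of_dsum_eqI[where A = D and B = C])
      (use d0 c d dQ in \<open>simp_all add: d\<^sub>0_def cr r(4)\<close>)
  have "E_triangle X B (col X B D C (\<^bold>- f') g) (D \<boxplus> C) (row X D C E\<^sub>0 d\<^sub>0 h\<^sub>0) E\<^sub>0 ?\<epsilon>"
  proof (rule E_triangle_iso_middle[OF TQ])
    show "is_iso X c' Q (D \<boxplus> C)" using c c' d dQ by (auto simp: is_iso_iff)
    show "c' \<cdot> q = col X B D C (\<^bold>- f') g"
      unfolding cq[symmetric] using cmp_prolong[OF c'(4), of "col X B D C (\<^bold>- f') g"] c c' d g by simp
    show "row X D C E\<^sub>0 d\<^sub>0 h\<^sub>0 \<cdot> c' = p" unfolding pc using c c' dQ by simp
  qed (use d0 d in simp_all)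
  moreover have "Emap X d\<^sub>0 (ident X A) \<delta>\<^sub>h = \<delta>\<^sub>f"
  proof -
    have "Emap X d\<^sub>0 (ident X A) \<delta>\<^sub>h
        = Emap X (inj1 X D C) (ident X A) (Emap X c (ident X A) (Emap X p (ident X A) \<delta>\<^sub>h))"
      unfolding d\<^sub>0_def using c d dQ by simp
    also have "\<dots> = \<delta>\<^sub>f" unfolding c\<delta> using d by simp
    finally show ?thesis .
  qed
  ultimately show thesis using that d0 by blast
qed

lemma ET4_2_imp_ET4_3:
  assumes ET4_2: "ET4_2 X"
  shows "ET4_3 X"
  unfolding ET4_3_def
proof (intro allI impI, elim conjE)
  fix A f B f' D \<delta>\<^sub>f g C g' F \<delta>\<^sub>g h h\<^sub>0 E\<^sub>0 \<delta>\<^sub>h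
  assume Tf: "E_triangle X A f B f' D \<delta>\<^sub>f" and Tg: "E_triangle X B g C g' F \<delta>\<^sub>g"
    and Th: "E_triangle X A h C h\<^sub>0 E\<^sub>0 \<delta>\<^sub>h" and h: "h = g \<cdot> f"
  note Th = Th[unfolded h]
  note d = E_triangleD[OF Tf] E_triangleD[OF Tg] E_triangleD[OF Th]
  obtain d\<^sub>0 where d0: "arr d\<^sub>0" "src d\<^sub>0 = D" "tgt d\<^sub>0 = E\<^sub>0"
    and S1: "E_triangle X B (col X B D C (\<^bold>- f') g) (D \<boxplus> C) (row X D C E\<^sub>0 d\<^sub>0 h\<^sub>0) E\<^sub>0
      (Emap X (ident X E\<^sub>0) f \<delta>\<^sub>h)"
    and d0\<delta>: "Emap X d\<^sub>0 (ident X A) \<delta>\<^sub>h = \<delta>\<^sub>f"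
    by (rule ET4_2_cobase_change[OF ET4_2 Tf d(14-16) Th])
  obtain u E v where TE: "E_triangle X D u E v F (Emap X (ident X F) f' \<delta>\<^sub>g)"
    by (rule E_triangle_exists[of D F "Emap X (ident X F) f' \<delta>\<^sub>g"]) (use d in auto)
  note dE = E_triangleD[OF TE]
  obtain k where k: "arr k" "src k = C" "tgt k = E" "v \<cdot> k = g'"
    and S2: "E_triangle X B (col X B D C (\<^bold>- f') g) (D \<boxplus> C) (row X D C E u k) E
      (Emap X v (ident X B) \<delta>\<^sub>g)"
    using ET4_2E[OF ET4_2 Tg d(7-9) TE] by metis
  obtain c where "is_iso X c E\<^sub>0 E" and c: "arr c" "src c = E\<^sub>0" "tgt c = E"
    and crow: "c \<cdot> row X D C E\<^sub>0 d\<^sub>0 h\<^sub>0 = row X D C E u k"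
    and c\<delta>: "Emap X c (ident X B) (Emap X v (ident X B) \<delta>\<^sub>g) = Emap X (ident X E\<^sub>0) f \<delta>\<^sub>h"
    by (rule cone_unique[OF S1 S2])
  then obtain c' where c': "arr c'" "src c' = E" "tgt c' = E\<^sub>0" "c' \<cdot> c = ident X E\<^sub>0"
    "c \<cdot> c' = ident X E" using d dE by (auto simp: is_iso_iff)
  have "(c \<cdot> row X D C E\<^sub>0 d\<^sub>0 h\<^sub>0) \<cdot> inj1 X D C = u" unfolding crow using k d dE by simp
  then have cd: "c \<cdot> d\<^sub>0 = u" using c d0 d by simp
  have "(c \<cdot> row X D C E\<^sub>0 d\<^sub>0 h\<^sub>0) \<cdot> inj2 X D C = k" unfolding crow using k d dE by simp
  then have ch: "c \<cdot> h\<^sub>0 = k" using c d0 d by simp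
  let ?e = "v \<cdot> c"
  have S: "E_triangle X D d\<^sub>0 E\<^sub>0 ?e F (Emap X (ident X F) f' \<delta>\<^sub>g)"
  proof (rule E_triangle_iso_middle[OF TE])
    show "is_iso X c' E E\<^sub>0" using c c' d dE by (auto simp: is_iso_iff)
    show "c' \<cdot> u = d\<^sub>0" unfolding cd[symmetric] using cmp_prolong[OF c'(4), of d\<^sub>0] c c' d0 by simp
  qed (use c c' d dE in simp_all)
  have "\<^bold>- (d\<^sub>0 \<cdot> f') \<^bold>+ h\<^sub>0 \<cdot> g = \<zero>\<^bsub>Hom X B E\<^sub>0\<^esub>"
    using E_triangle_cmp_zero[OF S1] d0 d by simp
  then have dg: "d\<^sub>0 \<cdot> f' = h\<^sub>0 \<cdot> g"
    using neg_arr_unique[of "\<^bold>- (d\<^sub>0 \<cdot> f')" "h\<^sub>0 \<cdot> g"] d0 d by simp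
  have eh: "?e \<cdot> h\<^sub>0 = g'" using c d dE ch k(4) by simp
  have "Emap X (ident X E\<^sub>0) f \<delta>\<^sub>h = Emap X ?e (ident X B) \<delta>\<^sub>g"
    unfolding c\<delta>[symmetric] using c d dE by simp
  then show "\<exists>d\<^sub>0 \<in> carrier (Hom X D E\<^sub>0). \<exists>e\<^sub>0 \<in> carrier (Hom X E\<^sub>0 F).
           d\<^sub>0 \<cdot> f' = h\<^sub>0 \<cdot> g \<and> e\<^sub>0 \<cdot> h\<^sub>0 = g' \<and>
           E_triangle X D d\<^sub>0 E\<^sub>0 e\<^sub>0 F (push X F f' \<delta>\<^sub>g) \<and>
           pull X A d\<^sub>0 \<delta>\<^sub>h = \<delta>\<^sub>f \<and> push X E\<^sub>0 f \<delta>\<^sub>h = pull X B e\<^sub>0 \<delta>\<^sub>g"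
    using S dg eh d0\<delta> d0 c d dE by (intro bexI[of _ d\<^sub>0] bexI[of _ ?e]) simp_all
qed

lemma ET4_3_ET0_imp_ET4:
  assumes ET4_3: "ET4_3 X" and ET0: "ET0 X"
  shows "ET4 X"
  unfolding ET4_def
proof (intro allI impI, elim conjE)
  fix A f B f' D \<delta> g C g' F \<delta>'
  assume Tf: "E_triangle X A f B f' D \<delta>" and Tg: "E_triangle X B g C g' F \<delta>'"
  then have "inflation X A (g \<cdot> f) C"
    using ET0 unfolding ET0_def inflation_def by blast
  then obtain h' E \<delta>'' where Th: "E_triangle X A (g \<cdot> f) C h' E \<delta>''"
    unfolding inflation_def by blast
  show "\<exists>E h h' \<delta>'' d e.
           E_triangle X A h C h' E \<delta>'' \<and> E_triangle X D d E e F (push X F f' \<delta>') \<and>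
           h = g \<cdot> f \<and> d \<cdot> f' = h' \<cdot> g \<and> e \<cdot> h' = g' \<and>
           pull X A d \<delta>'' = \<delta> \<and> push X E f \<delta>'' = pull X B e \<delta>'"
    using ET4_3[unfolded ET4_3_def, rule_format, of A f B f' D \<delta> g C g' F \<delta>' "g \<cdot> f" h' E \<delta>'']
      Tf Tg Th by blast
qed

end

theorem theorem1p2:
  fixes X :: "('o, 'm, 'e, 'z) ext_cat_scheme"
  assumes "pre_extriangulated X"
  shows "(ET4 X \<longleftrightarrow> ET4_1 X \<and> ET0 X) \<and>
         (ET4 X \<longleftrightarrow> ET4_2 X \<and> ET0 X) \<and>
         (ET4 X \<longleftrightarrow> ET4_3 X \<and> ET0 X) \<and>
         (ET4 X \<longleftrightarrow> ET4_5 X \<and> ET0 X)"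
proof -
  interpret pre_extriangulated X by (rule assms)
  show ?thesis
    using ET4_imp_ET0 ET4_imp_ET4_1 ET4_1_imp_ET4_5 ET4_5_imp_ET4_2 ET4_2_imp_ET4_3
      ET4_3_ET0_imp_ET4 by blast
qed

end
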